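(* Let $n$ be a positive integer and $\beta$ a composition. Then $$\mathcal S^*_{(n)}\cdot\mathcal S^*_\beta=\sum_\gamma\mathcal S^*_\gamma,$$ where $\gamma$ runs over all compositions $\gamma\ge_C\beta$ such that $|\gamma/\!/\beta|=n$ and $\gamma/\!/\beta$ is a horizontal strip where the cells have been added from left to right. Similarly, $$\mathcal S^*_{(1^n)}\cdot\mathcal S^*_\beta=\sum_\gamma\mathcal S^*_\gamma,$$ where $\gamma$ runs over all compositions $\gamma\ge_C\beta$ such that $|\gamma/\!/\beta|=n$ and $\gamma/\!/\beta$ is a vertical strip where the cells have been added from right to left.
   Context: A composition is a finite (possibly empty) sequence of positive integers. Its diagram has $\alpha_i$ left-justified cells in row $i$, rows numbered from the top; cells are indexed (row, column). $(1^n)$ is the composition with $n$ parts equal to 1. The poset $\mathcal L_C$ (order $\le_C$) on all compositions is generated by the cover relations: $\gamma$ covers $\beta$ if $\gamma$ is obtained from $\beta$ either by prepending a new part equal to 1 (adding a cell in column 1), or by adding 1 to the first (leftmost) part of $\beta$ of size $k$ for some $k$ (adding a cell in column $k+1$). If $\beta\le_C\gamma$, the diagram of $\beta$ is placed in the lower left of that of $\gamma$ (last rows aligned), $\gamma/\!/\beta$ is the set of cells of $\gamma$ not in $\beta$, and $|\gamma/\!/\beta|=|\gamma|-|\beta|$. A horizontal strip has at most one cell per column; a vertical strip has at most one cell per row. "The cells have been added from left to right" means that there is a saturated chain in $\mathcal L_C$ from $\beta$ to $\gamma$ in which the column indices of the successively added cells are increasing (strictly, as it is a horizontal strip); "added from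 right to left" means that there is a saturated chain from $\beta$ to $\gamma$ in which the column indices of the successively added cells are weakly decreasing. A semistandard composition tableau (SSCT) of (straight) shape $\alpha$ is a filling $T$ of the diagram of $\alpha$ by positive integers such that: rows weakly decrease left to right; the first column strictly increases top to bottom; and if $i<j$, $(i,k)$ and $(j,k+1)$ are cells of $\alpha$ and $T(j,k+1)\le T(i,k)$, then $(i,k+1)$ is a cell of $\alpha$ and $T(j,k+1)<T(i,k+1)$. The quasisymmetric Schur functions $\mathcal S_\alpha=\sum_T\prod_c x_{T(c)}$ (sum over SSCT of shape $\alpha$) form a basis of the Hopf algebra $QSym$ of quasisymmetric functions over $\mathbb Q$, with coproduct $\Delta M_\alpha=\sum_{\beta\gamma=\alpha}M_\beta\otimes M_\gamma$ (concatenation) on the monomial basis. $NSym$ is the graded Hopf dual of $QSym$ (product dual to $\Delta$: $\langle F,xy\rangle=\langle\Delta F,x\otimes y\rangle$) and $\{\mathcal S^*_\alpha\}$ is the basis of $NSym$ dual to $\{\mathcal S_\alpha\}$. *)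

theory Defs
  imports Complex_Main "HOL-Library.Multiset" "HOL-Library.Poly_Mapping"
begin

section \<open>Compositions and the poset \<open>L\<^sub>C\<close>\<close>

definition composition :: "nat list \<Rightarrow> bool" where
  "composition \<alpha> \<longleftrightarrow> 0 \<notin> set \<alpha>"

text \<open>Cells are pairs (row, column), both counted from 1, rows from the top.\<close>

definition cells :: "nat list \<Rightarrow> (nat \<times> nat) set" where
  "cells \<alpha> = {(i, j). 1 \<le> i \<and> i \<le> length \<alpha> \<and> 1 \<le> j \<and> j \<le> \<alpha> ! (i - 1)}"

text \<open>
  \<open>covers_at \<beta> c \<gamma>\<close>: \<open>\<gamma>\<close> covers \<open>\<beta>\<close> and the added cell lies in column \<open>c\<close>. In the second rule the
  part that grows is the leftmost one among the parts of size \<open>k\<close>.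
\<close>

inductive covers_at :: "nat list \<Rightarrow> nat \<Rightarrow> nat list \<Rightarrow> bool" where
  prepend: "covers_at \<beta> 1 (1 # \<beta>)"
| grow: "k \<notin> set \<beta>1 \<Longrightarrow> covers_at (\<beta>1 @ k # \<beta>2) (k + 1) (\<beta>1 @ (k + 1) # \<beta>2)"

definition le_C :: "nat list \<Rightarrow> nat list \<Rightarrow> bool"  (infix "\<le>\<^sub>C" 50) where
  "\<beta> \<le>\<^sub>C \<gamma> \<longleftrightarrow> (\<lambda>\<delta> \<epsilon>. \<exists>c. covers_at \<delta> c \<epsilon>)\<^sup>*\<^sup>* \<beta> \<gamma>"

text \<open>
  \<open>saturated_chain \<beta> cs \<gamma>\<close>: there is a saturated chain from \<open>\<beta>\<close> to \<open>\<gamma>\<close> along which the successively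
  added cells lie in the columns listed in \<open>cs\<close>.
\<close>

inductive saturated_chain :: "nat list \<Rightarrow> nat list \<Rightarrow> nat list \<Rightarrow> bool" where
  refl: "saturated_chain \<beta> [] \<beta>"
| step: "saturated_chain \<beta> cs \<gamma> \<Longrightarrow> covers_at \<gamma> c \<delta> \<Longrightarrow> saturated_chain \<beta> (cs @ [c]) \<delta>"

text \<open>\<open>skew_cells \<gamma> \<beta>\<close> is \<open>\<gamma>//\<beta>\<close>: the diagram of \<open>\<beta>\<close> is aligned with the last rows of \<open>\<gamma>\<close>.\<close>

definition skew_cells :: "nat list \<Rightarrow> nat list \<Rightarrow> (nat \<times> nat) set" where
  "skew_cells \<gamma> \<beta> = cells \<gamma> - (\<lambda>(i, j). (i + (length \<gamma> - length \<beta>), j)) ` cells \<beta>"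

definition skew_size :: "nat list \<Rightarrow> nat list \<Rightarrow> nat" where
  "skew_size \<gamma> \<beta> = sum_list \<gamma> - sum_list \<beta>"

definition horizontal_strip :: "(nat \<times> nat) set \<Rightarrow> bool" where
  "horizontal_strip D \<longleftrightarrow> (\<forall>i i' j. (i, j) \<in> D \<longrightarrow> (i', j) \<in> D \<longrightarrow> i = i')"

definition vertical_strip :: "(nat \<times> nat) set \<Rightarrow> bool" where
  "vertical_strip D \<longleftrightarrow> (\<forall>i j j'. (i, j) \<in> D \<longrightarrow> (i, j') \<in> D \<longrightarrow> j = j')"

definition added_left_to_right :: "nat list \<Rightarrow> nat list \<Rightarrow> bool" where
  "added_left_to_right \<beta> \<gamma> \<longleftrightarrow> (\<exists>cs. saturated_chain \<beta> cs \<gamma> \<and> sorted_wrt (<) cs)"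

definition added_right_to_left :: "nat list \<Rightarrow> nat list \<Rightarrow> bool" where
  "added_right_to_left \<beta> \<gamma> \<longleftrightarrow> (\<exists>cs. saturated_chain \<beta> cs \<gamma> \<and> sorted_wrt (\<ge>) cs)"


section \<open>Quasisymmetric functions over the rationals\<close>

text \<open>
  A monomial in \<open>x\<^sub>1, x\<^sub>2, \<dots>\<close> is the multiset of the indices of its variables, and a formal power
  series is the function giving its coefficients. Index 0 is not used: the coefficient of a monomial
  containing it is 0. The exponent composition of
  \<open>x\<^bsub>i1\<^esub>\<^bsup>a1\<^esup> \<cdots> x\<^bsub>ik\<^esub>\<^bsup>ak\<^esup>\<close> with \<open>i1 < \<cdots> < ik\<close> is \<open>[a1, \<dots>, ak]\<close>.
\<close>

definition exponents :: "nat multiset \<Rightarrow> nat list" where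
  "exponents m = map (count m) (sorted_list_of_set (set_mset m))"

definition quasisymmetric :: "(nat multiset \<Rightarrow> rat) \<Rightarrow> bool" where
  "quasisymmetric f \<longleftrightarrow>
     (\<forall>m. 0 \<in># m \<longrightarrow> f m = 0) \<and>
     (\<exists>d. \<forall>m. f m \<noteq> 0 \<longrightarrow> size m \<le> d) \<and>
     (\<forall>m m'. 0 \<notin># m \<longrightarrow> 0 \<notin># m' \<longrightarrow> exponents m = exponents m' \<longrightarrow> f m = f m')"

typedef qsym = "{f. quasisymmetric f}"
  morphisms qcoeff Abs_qsym
  by (rule exI[of _ "\<lambda>_. 0"]) (simp add: quasisymmetric_def)

setup_lifting type_definition_qsym

lemma quasisymmetricD:
  assumes "quasisymmetric f"
  shows "0 \<in># m \<Longrightarrow> f m = 0"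
    and "\<exists>d. \<forall>m. f m \<noteq> 0 \<longrightarrow> size m \<le> d"
    and "0 \<notin># m \<Longrightarrow> 0 \<notin># m' \<Longrightarrow> exponents m = exponents m' \<Longrightarrow> f m = f m'"
  using assms unfolding quasisymmetric_def by blast+

lemma quasisymmetric_lin:
  assumes "quasisymmetric f" "quasisymmetric g"
  shows "quasisymmetric (\<lambda>m. a * f m + b * g m)"
proof -
  obtain d e where "\<forall>m. f m \<noteq> 0 \<longrightarrow> size m \<le> d" "\<forall>m. g m \<noteq> 0 \<longrightarrow> size m \<le> e"
    using quasisymmetricD(2)[OF assms(1)] quasisymmetricD(2)[OF assms(2)] by blast
  then have "\<forall>m. a * f m + b * g m \<noteq> 0 \<longrightarrow> size m \<le> max d e"
    by (metis add_0 le_max_iff_disj mult_zero_right)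
  moreover have "a * f m + b * g m = a * f m' + b * g m'"
    if "0 \<notin># m" "0 \<notin># m'" "exponents m = exponents m'" for m m'
    using quasisymmetricD(3)[OF assms(1) that] quasisymmetricD(3)[OF assms(2) that] by simp
  moreover have "a * f m + b * g m = 0" if "0 \<in># m" for m
    using quasisymmetricD(1)[OF assms(1) that] quasisymmetricD(1)[OF assms(2) that] by simp
  ultimately show ?thesis unfolding quasisymmetric_def by blast
qed

instantiation qsym :: ab_group_add
begin

lift_definition zero_qsym :: qsym is "\<lambda>_. 0"
  by (simp add: quasisymmetric_def)

lift_definition plus_qsym :: "qsym \<Rightarrow> qsym \<Rightarrow> qsym" is "\<lambda>f g m. f m + g m"
  using quasisymmetric_lin[of _ _ 1 1] by simp

lift_definition minus_qsym :: "qsym \<Rightarrow> qsym \<Rightarrow> qsym" is "\<lambda>f g m. f m - g m"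
  using quasisymmetric_lin[of _ _ 1 "-1"] by simp

lift_definition uminus_qsym :: "qsym \<Rightarrow> qsym" is "\<lambda>f m. - f m"
  using quasisymmetric_lin[of _ _ "-1" 0] by simp

instance
  by standard (transfer, simp add: algebra_simps fun_eq_iff)+

end

lift_definition qscale :: "rat \<Rightarrow> qsym \<Rightarrow> qsym" is "\<lambda>c f m. c * f m"
  using quasisymmetric_lin[of _ _ _ 0] by simp

interpretation qsym: vector_space qscale
  by standard (transfer, simp add: algebra_simps fun_eq_iff)+

definition homogeneous :: "nat \<Rightarrow> qsym \<Rightarrow> bool" where
  "homogeneous d F \<longleftrightarrow> (\<forall>m. qcoeff F m \<noteq> 0 \<longrightarrow> size m = d)"

lemma sum_list_exponents: "sum_list (exponents m) = size m"
  unfolding exponents_def size_multiset_overloaded_eq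
  by (simp add: sum_list_distinct_conv_sum_set)

text \<open>The monomial quasisymmetric function \<open>M\<^sub>\<alpha>\<close> is the sum of all monomials with exponent composition \<open>\<alpha>\<close>.\<close>

lift_definition monomial_qsym :: "nat list \<Rightarrow> qsym"
  is "\<lambda>\<alpha> m. if 0 \<notin># m \<and> exponents m = \<alpha> then 1 else 0"
  unfolding quasisymmetric_def by (auto simp: sum_list_exponents[symmetric])


subsection \<open>Quasisymmetric Schur functions\<close>

text \<open>Fillings are extended by 0 outside the diagram, so that each filling is one function.\<close>

definition sscts :: "nat list \<Rightarrow> (nat \<times> nat \<Rightarrow> nat) set" where
  "sscts \<alpha> = {T.
     (\<forall>c. c \<notin> cells \<alpha> \<longrightarrow> T c = 0) \<and>
     (\<forall>c \<in> cells \<alpha>. T c > 0) \<and>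
     (\<forall>i j j'. j < j' \<longrightarrow> (i, j) \<in> cells \<alpha> \<longrightarrow> (i, j') \<in> cells \<alpha> \<longrightarrow> T (i, j') \<le> T (i, j)) \<and>
     (\<forall>i i'. i < i' \<longrightarrow> (i, 1) \<in> cells \<alpha> \<longrightarrow> (i', 1) \<in> cells \<alpha> \<longrightarrow> T (i, 1) < T (i', 1)) \<and>
     (\<forall>i j k. i < j \<longrightarrow> (i, k) \<in> cells \<alpha> \<longrightarrow> (j, k + 1) \<in> cells \<alpha> \<longrightarrow> T (j, k + 1) \<le> T (i, k) \<longrightarrow>
        (i, k + 1) \<in> cells \<alpha> \<and> T (j, k + 1) < T (i, k + 1))}"

text \<open>The index multiset of the monomial \<open>\<Prod>\<^sub>c x\<^bsub>T(c)\<^esub>\<close>.\<close>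

definition content :: "nat list \<Rightarrow> (nat \<times> nat \<Rightarrow> nat) \<Rightarrow> nat multiset" where
  "content \<alpha> T = image_mset T (mset_set (cells \<alpha>))"

lemma finite_cells: "finite (cells \<alpha>)"
proof (rule finite_subset)
  show "cells \<alpha> \<subseteq> {..length \<alpha>} \<times> {..sum_list \<alpha>}"
    by (auto simp: cells_def intro: order_trans[OF _ member_le_sum_list])
qed simp

lemma set_mset_content: "set_mset (content \<alpha> T) = T ` cells \<alpha>"
  by (simp add: content_def finite_cells)

lemma relabel_ssct:
  assumes T: "T \<in> sscts \<alpha>" and \<phi>: "strict_mono_on (T ` cells \<alpha>) \<phi>" "\<forall>i \<in> T ` cells \<alpha>. \<phi> i > 0"
  shows "(\<lambda>c. if c \<in> cells \<alpha> then \<phi> (T c) else 0) \<in> sscts \<alpha>"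
proof -
  have le: "\<phi> (T c) \<le> \<phi> (T c') \<longleftrightarrow> T c \<le> T c'" if "c \<in> cells \<alpha>" "c' \<in> cells \<alpha>" for c c'
    using that \<phi>(1) by (simp add: strict_mono_on_less_eq)
  have less: "\<phi> (T c) < \<phi> (T c') \<longleftrightarrow> T c < T c'" if "c \<in> cells \<alpha>" "c' \<in> cells \<alpha>" for c c'
    using that \<phi>(1) by (simp add: strict_mono_on_less)
  show ?thesis
    using T \<phi>(2) unfolding sscts_def by (simp add: le less)
qed

lemma order_isomorphism_exponents:
  assumes e: "exponents m = exponents m'"
  obtains \<phi> \<psi> where
    "strict_mono_on (set_mset m) \<phi>" "image_mset \<phi> m = m'"
    "strict_mono_on (set_mset m') \<psi>" "image_mset \<psi> m' = m"
    "\<forall>i \<in># m. \<psi> (\<phi> i) = i" "\<forall>i \<in># m'. \<phi> (\<psi> i) = i"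
proof -
  define lst :: "nat multiset \<Rightarrow> nat list" where "lst m = sorted_list_of_set (set_mset m)" for m
  define n where "n = length (lst m)"
  define relabel where "relabel a b = (\<lambda>x. the (map_of (zip (lst a) (lst b)) x))" for a b
  have len: "length (lst m) = n" "length (lst m') = n"
    using arg_cong[OF e, of length] by (simp_all add: exponents_def n_def lst_def)
  have cnt: "count m (lst m ! i) = count m' (lst m' ! i)" if "i < n" for i
    using arg_cong[OF e, of "\<lambda>l. l ! i"] that len by (simp add: exponents_def lst_def)
  have set: "set_mset a = (!) (lst a) ` {..<n}" if "length (lst a) = n" for a
  proof -
    have "set_mset a = set (lst a)" by (simp add: lst_def)
    then show ?thesis using that by (auto simp: set_conv_nth)
  qed
  have less: "lst a ! i < lst a ! j \<longleftrightarrow> i < j" if "length (lst a) = n" "i < n" "j < n" for a i j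
    using that unfolding lst_def
    by (metis linorder_neqE_nat order_less_asym sorted_wrt_nth_less strict_sorted_list_of_set)
  have inj: "lst a ! i = lst a ! j \<longleftrightarrow> i = j" if "length (lst a) = n" "i < n" "j < n" for a i j
    using that by (simp add: lst_def nth_eq_iff_index_eq)
  have nth: "relabel a b (lst a ! i) = lst b ! i"
    if "length (lst a) = n" "length (lst b) = n" "i < n" for a b i
    using that by (simp add: relabel_def map_of_zip_nth lst_def)
  have mono: "strict_mono_on (set_mset a) (relabel a b)"
    if "length (lst a) = n" "length (lst b) = n" for a b
    using that by (auto simp: strict_mono_on_def set nth less)
  have inv: "\<forall>i \<in># a. relabel b a (relabel a b i) = i"
    if "length (lst a) = n" "length (lst b) = n" for a b
    using that by (auto simp: set nth)
  have img: "image_mset (relabel a b) a = b"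
    if l: "length (lst a) = n" "length (lst b) = n"
      and c: "\<And>i. i < n \<Longrightarrow> count a (lst a ! i) = count b (lst b ! i)" for a b
  proof (rule multiset_eqI)
    fix x
    show "count (image_mset (relabel a b) a) x = count b x"
    proof (cases "x \<in># b")
      case True
      then obtain i where i: "i < n" "x = lst b ! i" using set[OF l(2)] by auto
      have "relabel a b -` {x} \<inter> set_mset a = {lst a ! i}"
        using i l by (auto simp: set nth inj)
      then show ?thesis using c i by (simp add: count_image_mset)
    next
      case False
      then have "relabel a b -` {x} \<inter> set_mset a = {}"
        using l by (auto simp: set nth)
      then show ?thesis using False by (simp add: count_image_mset not_in_iff)
    qed
  qed
  show ?thesis
    using that[of "relabel m m'" "relabel m' m"] len cnt mono inv img by simp
qed

lemma card_ssct_content_eq: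
  assumes "0 \<notin># m" "0 \<notin># m'" "exponents m = exponents m'"
  shows "card {T \<in> sscts \<alpha>. content \<alpha> T = m} = card {T \<in> sscts \<alpha>. content \<alpha> T = m'}"
proof -
  obtain \<phi> \<psi> where iso:
    "strict_mono_on (set_mset m) \<phi>" "image_mset \<phi> m = m'"
    "strict_mono_on (set_mset m') \<psi>" "image_mset \<psi> m' = m"
    "\<forall>i \<in># m. \<psi> (\<phi> i) = i" "\<forall>i \<in># m'. \<phi> (\<psi> i) = i"
    using order_isomorphism_exponents[OF assms(3)] by metis
  define R where "R f T = (\<lambda>c. if c \<in> cells \<alpha> then f (T c) else 0)" for f :: "nat \<Rightarrow> nat" and T
  have R: "R f T \<in> sscts \<alpha> \<and> content \<alpha> (R f T) = b"
    if "strict_mono_on (set_mset a) f" "image_mset f a = b" "0 \<notin># b"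
      and T: "T \<in> sscts \<alpha>" "content \<alpha> T = a" for f T a b
  proof -
    have s: "T ` cells \<alpha> = set_mset a" using T(2) set_mset_content by metis
    have "\<forall>i \<in> T ` cells \<alpha>. f i > 0" using that(2,3) s by (auto intro: gr0I)
    then have "R f T \<in> sscts \<alpha>"
      unfolding R_def using relabel_ssct[OF T(1)] that(1) s by simp
    moreover have "content \<alpha> (R f T) = image_mset f (content \<alpha> T)"
      unfolding content_def multiset.map_comp
      by (rule image_mset_cong) (simp add: R_def finite_cells)
    ultimately show ?thesis using that(2) T(2) by simp
  qed
  have RR: "R g (R f T) = T"
    if T: "T \<in> sscts \<alpha>" "content \<alpha> T = a" and gf: "\<forall>i \<in># a. g (f i) = i" for f g T a
  proof
    fix c
    have "T c \<in># a" if "c \<in> cells \<alpha>" using that T(2) set_mset_content by blast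
    moreover have "T c = 0" if "c \<notin> cells \<alpha>" using that T(1) unfolding sscts_def by blast
    ultimately show "R g (R f T) c = T c" using gf by (auto simp: R_def)
  qed
  have "bij_betw (R \<phi>) {T \<in> sscts \<alpha>. content \<alpha> T = m} {T \<in> sscts \<alpha>. content \<alpha> T = m'}"
  proof (rule bij_betw_byWitness[where f' = "R \<psi>"])
    show "\<forall>T \<in> {T \<in> sscts \<alpha>. content \<alpha> T = m}. R \<psi> (R \<phi> T) = T"
      using RR iso(5) by blast
    show "\<forall>T \<in> {T \<in> sscts \<alpha>. content \<alpha> T = m'}. R \<phi> (R \<psi> T) = T"
      using RR iso(6) by blast
    show "R \<phi> ` {T \<in> sscts \<alpha>. content \<alpha> T = m} \<subseteq> {T \<in> sscts \<alpha>. content \<alpha> T = m'}"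
      using R[OF iso(1,2) assms(2)] by blast
    show "R \<psi> ` {T \<in> sscts \<alpha>. content \<alpha> T = m'} \<subseteq> {T \<in> sscts \<alpha>. content \<alpha> T = m}"
      using R[OF iso(3,4) assms(1)] by blast
  qed
  then show ?thesis by (rule bij_betw_same_card)
qed

text \<open>\<open>qschur \<alpha>\<close> is \<open>S\<^sub>\<alpha>\<close>.\<close>

lift_definition qschur :: "nat list \<Rightarrow> qsym"
  is "\<lambda>\<alpha> m. of_nat (card {T \<in> sscts \<alpha>. content \<alpha> T = m})"
proof -
  fix \<alpha>
  let ?A = "\<lambda>m. {T \<in> sscts \<alpha>. content \<alpha> T = m}"
  show "quasisymmetric (\<lambda>m. of_nat (card (?A m)))"
    unfolding quasisymmetric_def
  proof (intro conjI allI impI exI[of _ "card (cells \<alpha>)"])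
    fix m :: "nat multiset" assume m: "0 \<in># m"
    have "content \<alpha> T \<noteq> m" if T: "T \<in> sscts \<alpha>" for T
    proof
      assume "content \<alpha> T = m"
      then have "0 \<in> T ` cells \<alpha>" using m set_mset_content by blast
      moreover have "\<forall>c \<in> cells \<alpha>. T c > 0" using T unfolding sscts_def by blast
      ultimately show False by auto
    qed
    then have "?A m = {}" by blast
    then show "of_nat (card (?A m)) = (0 :: rat)" by (metis card.empty of_nat_0)
  next
    fix m :: "nat multiset" assume "of_nat (card (?A m)) \<noteq> (0 :: rat)"
    then have "?A m \<noteq> {}" by (metis card.empty of_nat_0)
    then obtain T where "content \<alpha> T = m" by blast
    then show "size m \<le> card (cells \<alpha>)" by (auto simp: content_def)
  next
    fix m m' :: "nat multiset"
    assume "0 \<notin># m" "0 \<notin># m'" "exponents m = exponents m'"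
    then show "of_nat (card (?A m)) = (of_nat (card (?A m')) :: rat)"
      by (rule card_ssct_content_eq[THEN arg_cong])
  qed
qed


subsection \<open>Coproduct\<close>

definition canonical_monomial :: "nat list \<Rightarrow> nat multiset" where
  "canonical_monomial \<alpha> = (\<Sum>i<length \<alpha>. replicate_mset (\<alpha> ! i) (i + 1))"

text \<open>
  The coefficient of \<open>M\<^sub>\<alpha>\<close> in \<open>F\<close> is the coefficient of \<open>x\<^sub>1\<^bsup>a1\<^esup> \<cdots> x\<^sub>k\<^bsup>ak\<^esup>\<close>,
  where \<open>\<alpha> = [a1, \<dots>, ak]\<close>.
\<close>

definition mcoeff :: "qsym \<Rightarrow> nat list \<Rightarrow> rat" where
  "mcoeff F \<alpha> = qcoeff F (canonical_monomial \<alpha>)"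

definition msupp :: "qsym \<Rightarrow> nat list set" where
  "msupp F = {\<alpha>. composition \<alpha> \<and> mcoeff F \<alpha> \<noteq> 0}"

text \<open>
  An element of \<open>QSym \<otimes> QSym\<close> is given by its coordinates in the basis of all
  \<open>M\<^sub>\<beta> \<otimes> M\<^sub>\<gamma>\<close>; the basis element is the unit vector at \<open>(\<beta>, \<gamma>)\<close>. The coproduct is the linear
  map sending \<open>M\<^sub>\<alpha>\<close> to the sum of \<open>M\<^sub>\<beta> \<otimes> M\<^sub>\<gamma>\<close> over all \<open>\<beta>\<close>, \<open>\<gamma>\<close> with \<open>\<beta> @ \<gamma> = \<alpha>\<close>.
\<close>

definition coproduct :: "qsym \<Rightarrow> (nat list \<times> nat list) \<Rightarrow>\<^sub>0 rat" where
  "coproduct F = (\<Sum>\<alpha> \<in> msupp F. \<Sum>(\<beta>, \<gamma>) | \<beta> @ \<gamma> = \<alpha>. Poly_Mapping.single (\<beta>, \<gamma>) (mcoeff F \<alpha>))"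

lemma size_canonical_monomial: "size (canonical_monomial \<alpha>) = sum_list \<alpha>"
  by (simp add: canonical_monomial_def sum_list_sum_nth atLeast0LessThan)

lemma length_le_sum_list: "composition \<alpha> \<Longrightarrow> length \<alpha> \<le> sum_list \<alpha>"
  by (induction \<alpha>) (auto simp: composition_def)

lemma finite_msupp: "finite (msupp F)"
proof -
  obtain d where d: "\<forall>m. qcoeff F m \<noteq> 0 \<longrightarrow> size m \<le> d"
    using quasisymmetricD(2) qcoeff by blast
  have "msupp F \<subseteq> {\<alpha>. set \<alpha> \<subseteq> {..d} \<and> length \<alpha> \<le> d}"
  proof
    fix \<alpha> assume "\<alpha> \<in> msupp F"
    then have "composition \<alpha>" "sum_list \<alpha> \<le> d"
      using d by (auto simp: msupp_def mcoeff_def size_canonical_monomial[symmetric])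
    then show "\<alpha> \<in> {\<alpha>. set \<alpha> \<subseteq> {..d} \<and> length \<alpha> \<le> d}"
      using length_le_sum_list[of \<alpha>] member_le_sum_list[of _ \<alpha>] by fastforce
  qed
  then show ?thesis using finite_lists_length_le[of "{..d}" d] finite_subset by auto
qed

lemma lookup_coproduct:
  "Poly_Mapping.lookup (coproduct F) (\<beta>, \<gamma>) = (if composition (\<beta> @ \<gamma>) then mcoeff F (\<beta> @ \<gamma>) else 0)"
proof -
  have fin: "finite {(\<beta>, \<gamma>). \<beta> @ \<gamma> = \<alpha>}" for \<alpha> :: "nat list"
  proof (rule finite_subset)
    show "{(\<beta>, \<gamma>). \<beta> @ \<gamma> = \<alpha>} \<subseteq> (\<lambda>k. (take k \<alpha>, drop k \<alpha>)) ` {..length \<alpha>}"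
    proof clarify
      fix \<beta> \<gamma> assume "\<alpha> = \<beta> @ \<gamma>"
      then show "(\<beta>, \<gamma>) \<in> (\<lambda>k. (take k (\<beta> @ \<gamma>), drop k (\<beta> @ \<gamma>))) ` {..length (\<beta> @ \<gamma>)}"
        by (intro image_eqI[of _ _ "length \<beta>"]) simp_all
    qed
  qed simp
  have "Poly_Mapping.lookup (coproduct F) (\<beta>, \<gamma>) =
      (\<Sum>\<alpha> \<in> msupp F. \<Sum>p | fst p @ snd p = \<alpha>. if p = (\<beta>, \<gamma>) then mcoeff F \<alpha> else 0)"
    by (simp add: coproduct_def lookup_sum lookup_single when_def case_prod_unfold)
  also have "\<dots> = (\<Sum>\<alpha> \<in> msupp F. if \<alpha> = \<beta> @ \<gamma> then mcoeff F \<alpha> else 0)"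
    using fin by (intro sum.cong) (auto simp: sum.delta case_prod_unfold)
  also have "\<dots> = (if composition (\<beta> @ \<gamma>) then mcoeff F (\<beta> @ \<gamma>) else 0)"
    by (simp add: finite_msupp) (simp add: msupp_def)
  finally show ?thesis .
qed


section \<open>Noncommutative symmetric functions\<close>

text \<open>
  \<open>NSym\<close> is the graded dual of \<open>QSym\<close>: the linear functionals that vanish on all homogeneous
  components of sufficiently large degree. \<open>pairing F x\<close> is \<open>\<langle>F, x\<rangle>\<close>.
\<close>

definition graded_functional :: "(qsym \<Rightarrow> rat) \<Rightarrow> bool" where
  "graded_functional x \<longleftrightarrow> Vector_Spaces.linear qscale (*) x \<and>
     (\<exists>d. \<forall>k>d. \<forall>F. homogeneous k F \<longrightarrow> x F = 0)"

lemma linear_qsym_iff: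
  "Vector_Spaces.linear qscale (*) x \<longleftrightarrow>
     (\<forall>F G. x (F + G) = x F + x G) \<and> (\<forall>c F. x (qscale c F) = c * x F)"
proof -
  have "vector_space ((*) :: rat \<Rightarrow> rat \<Rightarrow> rat)"
    by standard (simp_all add: algebra_simps)
  then show ?thesis
    using qsym.vector_space_axioms by (auto simp: Vector_Spaces.linear_iff)
qed

lemma graded_functional_lin:
  assumes "graded_functional x" "graded_functional y"
  shows "graded_functional (\<lambda>F. a * x F + b * y F)"
proof -
  obtain d e where d: "\<forall>k>d. \<forall>F. homogeneous k F \<longrightarrow> x F = 0"
    and e: "\<forall>k>e. \<forall>F. homogeneous k F \<longrightarrow> y F = 0"
    using assms unfolding graded_functional_def by blast
  have "a * x F + b * y F = 0" if "k > max d e" "homogeneous k F" for k F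
  proof -
    have "x F = 0" "y F = 0" using that d e by auto
    then show ?thesis by simp
  qed
  then show ?thesis
    using assms unfolding graded_functional_def linear_qsym_iff
    by (intro conjI exI[of _ "max d e"]) (simp_all add: algebra_simps)
qed

lemma graded_functional_0: "graded_functional (\<lambda>_. 0)"
  by (simp add: graded_functional_def linear_qsym_iff)

typedef nsym = "{x. graded_functional x}"
  morphisms functional Abs_nsym
  using graded_functional_0 by blast

setup_lifting type_definition_nsym

definition pairing :: "qsym \<Rightarrow> nsym \<Rightarrow> rat" where
  "pairing F x = functional x F"

instantiation nsym :: ab_group_add
begin

lift_definition zero_nsym :: nsym is "\<lambda>_. 0"
  by (rule graded_functional_0)

lift_definition plus_nsym :: "nsym \<Rightarrow> nsym \<Rightarrow> nsym" is "\<lambda>x y F. x F + y F"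
  using graded_functional_lin[of _ _ 1 1] by simp

lift_definition minus_nsym :: "nsym \<Rightarrow> nsym \<Rightarrow> nsym" is "\<lambda>x y F. x F - y F"
  using graded_functional_lin[of _ _ 1 "-1"] by simp

lift_definition uminus_nsym :: "nsym \<Rightarrow> nsym" is "\<lambda>x F. - x F"
  using graded_functional_lin[of _ _ "-1" 0] by simp

instance
  by standard (transfer, simp add: algebra_simps fun_eq_iff)+

end

text \<open>
  \<open>tensor_pairing t x y\<close> is \<open>\<langle>t, x \<otimes> y\<rangle>\<close>, that is, the linear extension of
  \<open>\<langle>F \<otimes> G, x \<otimes> y\<rangle> = \<langle>F, x\<rangle> \<langle>G, y\<rangle>\<close>.
\<close>

definition tensor_pairing ::
    "((nat list \<times> nat list) \<Rightarrow>\<^sub>0 rat) \<Rightarrow> (qsym \<Rightarrow> rat) \<Rightarrow> (qsym \<Rightarrow> rat) \<Rightarrow> rat" where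
  "tensor_pairing t x y =
     (\<Sum>(\<beta>, \<gamma>) \<in> Poly_Mapping.keys t.
        Poly_Mapping.lookup t (\<beta>, \<gamma>) * (x (monomial_qsym \<beta>) * y (monomial_qsym \<gamma>)))"

lemma tensor_pairing_superset:
  assumes "finite S" "Poly_Mapping.keys t \<subseteq> S"
  shows "tensor_pairing t x y =
     (\<Sum>(\<beta>, \<gamma>) \<in> S. Poly_Mapping.lookup t (\<beta>, \<gamma>) * (x (monomial_qsym \<beta>) * y (monomial_qsym \<gamma>)))"
  unfolding tensor_pairing_def using assms
  by (intro sum.mono_neutral_left) (auto simp: in_keys_iff)

lemma coproduct_add: "coproduct (F + G) = coproduct F + coproduct G"
  by (rule poly_mapping_eqI)
    (auto simp: lookup_add lookup_coproduct mcoeff_def plus_qsym.rep_eq)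

lemma homogeneous_monomial_qsym: "homogeneous (sum_list \<alpha>) (monomial_qsym \<alpha>)"
  by (auto simp: homogeneous_def monomial_qsym.rep_eq sum_list_exponents)

lemma tensor_pairing_add:
  "tensor_pairing (s + t) x y = tensor_pairing s x y + tensor_pairing t x y"
proof -
  let ?S = "Poly_Mapping.keys s \<union> Poly_Mapping.keys t"
  have "Poly_Mapping.keys (s + t) \<subseteq> ?S" by (rule keys_add)
  then show ?thesis
    by (simp add: tensor_pairing_superset[of ?S] lookup_add sum.distrib[symmetric] case_prod_unfold algebra_simps)
qed

lemma tensor_pairing_coproduct_scale:
  "tensor_pairing (coproduct (qscale c F)) x y = c * tensor_pairing (coproduct F) x y"
proof -
  have l: "Poly_Mapping.lookup (coproduct (qscale c F)) p = c * Poly_Mapping.lookup (coproduct F) p" for p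
    by (cases p) (simp add: lookup_coproduct mcoeff_def qscale.rep_eq)
  then have "Poly_Mapping.keys (coproduct (qscale c F)) \<subseteq> Poly_Mapping.keys (coproduct F)"
    by (auto simp: in_keys_iff)
  then show ?thesis
    by (simp add: tensor_pairing_superset[of "Poly_Mapping.keys (coproduct F)"] l
        sum_distrib_left case_prod_unfold algebra_simps)
qed

lemma graded_functional_tensor_pairing:
  assumes x: "graded_functional x" and y: "graded_functional y"
  shows "graded_functional (\<lambda>F. tensor_pairing (coproduct F) x y)"
proof -
  obtain d e where d: "\<forall>k>d. \<forall>F. homogeneous k F \<longrightarrow> x F = 0"
    and e: "\<forall>k>e. \<forall>F. homogeneous k F \<longrightarrow> y F = 0"
    using assms unfolding graded_functional_def by blast
  have "tensor_pairing (coproduct F) x y = 0" if k: "k > d + e" and F: "homogeneous k F" for k F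
    unfolding tensor_pairing_def
  proof (rule sum.neutral, clarify)
    fix \<beta> \<gamma> assume "(\<beta>, \<gamma>) \<in> Poly_Mapping.keys (coproduct F)"
    then have "mcoeff F (\<beta> @ \<gamma>) \<noteq> 0"
      by (auto simp: in_keys_iff lookup_coproduct split: if_splits)
    then have "sum_list \<beta> + sum_list \<gamma> = k"
      using F by (metis homogeneous_def mcoeff_def size_canonical_monomial sum_list_append)
    then have "sum_list \<beta> > d \<or> sum_list \<gamma> > e" using k by linarith
    then have "x (monomial_qsym \<beta>) = 0 \<or> y (monomial_qsym \<gamma>) = 0"
      using d e homogeneous_monomial_qsym by blast
    then show "Poly_Mapping.lookup (coproduct F) (\<beta>, \<gamma>) * (x (monomial_qsym \<beta>) * y (monomial_qsym \<gamma>)) = 0"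
      by auto
  qed
  then show ?thesis
    unfolding graded_functional_def linear_qsym_iff
    by (auto simp: coproduct_add tensor_pairing_add tensor_pairing_coproduct_scale)
qed

instantiation nsym :: times
begin

lift_definition times_nsym :: "nsym \<Rightarrow> nsym \<Rightarrow> nsym"
  is "\<lambda>x y F. tensor_pairing (coproduct F) x y"
  by (rule graded_functional_tensor_pairing)

instance ..

end

text \<open>\<open>dual_qschur \<alpha>\<close> is \<open>S\<^sup>*\<^sub>\<alpha>\<close>, the member at \<open>\<alpha>\<close> of the basis dual to the quasisymmetric Schur functions.\<close>

definition dual_qschur :: "nat list \<Rightarrow> nsym" where
  "dual_qschur \<alpha> = (THE x. \<forall>\<beta>. composition \<beta> \<longrightarrow> pairing (qschur \<beta>) x = (if \<beta> = \<alpha> then 1 else 0))"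

end

theory Submission
  imports Defs
begin

text \<open>
  Let \<open>K(\<gamma>, \<alpha>)\<close> be the coefficient of \<open>M\<^sub>\<alpha>\<close> in \<open>S\<^sub>\<gamma>\<close>, the number of tableaux of shape \<open>\<gamma>\<close> and weight \<open>\<alpha>\<close>.
  Deleting the entries 1 of a tableau of shape \<open>\<gamma>\<close> and lowering all others by 1 leaves a tableau of
  some shape \<open>\<beta>\<close>, and the conditions on a tableau say precisely that the deleted cells can be put back
  from left to right along covers of \<open>L\<^sub>C\<close>. Therefore \<open>K(\<gamma>, a # \<alpha>)\<close> is the sum of the \<open>K(\<beta>, \<alpha>)\<close> over all
  \<open>\<beta>\<close> from which such a strip of \<open>a\<close> cells leads to \<open>\<gamma>\<close> (\<open>kostka_Cons\<close>). Everything else is a consequence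
  of this recursion.

  By induction on the weight, \<open>K(\<gamma>, \<alpha>) \<noteq> 0\<close> forces \<open>\<gamma> = \<alpha>\<close> or makes the sum of the heights of the cells
  smaller for \<open>\<gamma>\<close> than for \<open>\<alpha>\<close>, while \<open>K(\<alpha>, \<alpha>) = 1\<close>. So \<open>K\<close> is unitriangular, the dual basis exists, and an
  element of \<open>NSym\<close> is determined by its values on the \<open>S\<^sub>\<gamma>\<close> (\<open>functional_dual_qschur\<close>,
  \<open>nsym_eqI_qschur\<close>). It remains to evaluate both sides of each product formula at every \<open>S\<^sub>\<gamma>\<close>.

  The functional \<open>S\<^sup>*\<^bsub>(n)\<^esub>\<close> reads off the coefficient of \<open>M\<^bsub>(n)\<^esub>\<close>. Since the coproduct cuts words of parts,
  the value of \<open>S\<^sup>*\<^bsub>(n)\<^esub> z\<close> at \<open>S\<^sub>\<gamma>\<close> only involves the coefficients \<open>K(\<gamma>, n # \<alpha>)\<close>, and by the recursion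
  it is the sum of the values of \<open>z\<close> at the \<open>S\<^sub>\<beta>\<close> with \<open>\<gamma>\<close> over \<open>\<beta>\<close> a strip of size \<open>n\<close> added from left to
  right. That is the first formula.

  For the second one, let \<open>e\<^sub>n\<close> send \<open>M\<^sub>\<alpha>\<close> to \<open>(-1)\<^bsup>n - length \<alpha>\<^esup>\<close> if \<open>\<alpha>\<close> has size \<open>n\<close> and to 0 otherwise. Splitting
  off the first part of \<open>\<alpha>\<close> gives, for \<open>n > 0\<close>, \<open>e\<^sub>n z = \<Sum> (-1)\<^bsup>i-1\<^esup> S\<^sup>*\<^bsub>(i)\<^esub> (e\<^bsub>n-i\<^esub> z)\<close>, the sum over \<open>1 \<le> i \<le> n\<close>. A saturated
  chain is determined by its start and the word of its columns. Hence, by induction on \<open>n\<close>, the value of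
  \<open>e\<^sub>n S\<^sup>*\<^sub>\<beta>\<close> at \<open>S\<^sub>\<gamma>\<close> is 1 if a weakly decreasing word of length \<open>n\<close> leads from \<open>\<beta>\<close> to \<open>\<gamma>\<close>, and 0 otherwise,
  as soon as the following cancellation is known: the ways to split a given nonempty word into a weakly
  decreasing prefix and a strictly increasing suffix, counted with sign according to the length of
  the prefix, add up to 0. They do, because such splittings come in pairs that differ in the side to
  which one letter at the cut belongs (\<open>alternating_sum_of_splits\<close>). Finally \<open>S\<^sup>*\<^bsub>()\<^esub>\<close> is a unit and
  \<open>1 \<cdots> 1\<close> is the only weakly decreasing word that can be applied to the empty composition, so
  \<open>e\<^sub>n = S\<^sup>*\<^bsub>(1\<^sup>n)\<^esub>\<close>.
\<close>

section \<open>Diagrams with rows counted from the bottom\<close>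

text \<open>
  In \<open>L\<^sub>C\<close> diagrams grow at the top and are compared with their last rows aligned. If rows are numbered
  from the bottom, starting with 0, containment of aligned diagrams is plain inclusion of sets of cells,
  and no index ever has to be shifted.
\<close>

definition height_cells :: "nat list \<Rightarrow> (nat \<times> nat) set" where
  "height_cells \<beta> = {(h, j). h < length \<beta> \<and> 1 \<le> j \<and> j \<le> rev \<beta> ! h}"

lemma height_cells_conv_cells:
  assumes "h < length \<beta>"
  shows "(h, j) \<in> height_cells \<beta> \<longleftrightarrow> (length \<beta> - h, j) \<in> cells \<beta>"
  using assms by (auto simp: height_cells_def cells_def rev_nth)

lemma height_cells_image: "height_cells \<beta> = (\<lambda>(i, j). (length \<beta> - i, j)) ` cells \<beta>"
proof -
  have "(h, j) \<in> (\<lambda>(i, j). (length \<beta> - i, j)) ` cells \<beta>" if "(h, j) \<in> height_cells \<beta>" for h j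
  proof -
    have "h < length \<beta>" using that by (auto simp: height_cells_def)
    then show ?thesis using that height_cells_conv_cells[of h \<beta> j]
      by (intro image_eqI[of _ _ "(length \<beta> - h, j)"]) auto
  qed
  moreover have "(length \<beta> - i, j) \<in> height_cells \<beta>" if "(i, j) \<in> cells \<beta>" for i j
    using that height_cells_conv_cells[of "length \<beta> - i" \<beta> j] by (auto simp: cells_def)
  ultimately show ?thesis by auto
qed

lemma inj_on_flip: "inj_on (\<lambda>(i, j). (length \<beta> - i, j)) (cells \<beta>)"
  by (auto simp: inj_on_def cells_def)

lemma finite_height_cells [simp]: "finite (height_cells \<beta>)"
  by (simp add: height_cells_image finite_cells)

lemma height_cells_Nil [simp]: "height_cells [] = {}"
  by (auto simp: height_cells_def)

lemma height_cells_Cons: "height_cells (a # \<beta>) = height_cells \<beta> \<union> {length \<beta>} \<times> {1..a}"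
  by (auto simp: height_cells_def nth_append split: if_splits)

lemma card_height_cells: "card (height_cells \<beta>) = sum_list \<beta>"
proof (induction \<beta>)
  case (Cons a \<beta>)
  have "height_cells \<beta> \<inter> {length \<beta>} \<times> {1..a} = {}" by (auto simp: height_cells_def)
  then show ?case using Cons by (simp add: height_cells_Cons card_Un_disjoint card_cartesian_product)
qed simp

lemma height_cells_pos: "(h, j) \<in> height_cells \<beta> \<Longrightarrow> 1 \<le> j"
  by (auto simp: height_cells_def)

lemma height_cells_left: "(h, j) \<in> height_cells \<beta> \<Longrightarrow> 1 \<le> i \<Longrightarrow> i \<le> j \<Longrightarrow> (h, i) \<in> height_cells \<beta>"
  by (auto simp: height_cells_def)

lemma height_cells_column1:
  assumes "composition \<beta>" shows "(h, 1) \<in> height_cells \<beta> \<longleftrightarrow> h < length \<beta>"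
proof -
  have "0 < rev \<beta> ! h" if "h < length \<beta>"
    using that assms by (metis composition_def gr0I length_rev nth_mem set_rev)
  then show ?thesis by (auto simp: height_cells_def Suc_le_eq)
qed

lemma card_row: "card {j. (h, j) \<in> height_cells \<beta>} = (if h < length \<beta> then rev \<beta> ! h else 0)"
proof -
  have "{j. (h, j) \<in> height_cells \<beta>} = (if h < length \<beta> then {1..rev \<beta> ! h} else {})"
    by (auto simp: height_cells_def)
  then show ?thesis by simp
qed

lemma composition_eqI:
  assumes "composition \<beta>" "composition \<gamma>" and eq: "height_cells \<beta> = height_cells \<gamma>"
  shows "\<beta> = \<gamma>"
proof -
  have lt: "h < length \<beta> \<longleftrightarrow> h < length \<gamma>" for h
    using assms height_cells_column1 by metis
  then have len: "length \<beta> = length \<gamma>"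
    by (metis less_irrefl_nat linorder_neqE_nat)
  have "rev \<beta> ! h = rev \<gamma> ! h" if "h < length \<beta>" for h
    using card_row[of h \<beta>] card_row[of h \<gamma>] that eq len by simp
  with len have "rev \<beta> = rev \<gamma>" by (intro nth_equalityI) simp_all
  then show ?thesis by simp
qed

lemma initial_segment:
  fixes A :: "nat set"
  assumes "finite A" "\<And>i j. j \<in> A \<Longrightarrow> i < j \<Longrightarrow> i \<in> A"
  shows "A = {..<card A}"
proof (cases "A = {}")
  case False
  then have M: "Max A \<in> A" "\<And>i. i \<in> A \<Longrightarrow> i \<le> Max A" using assms(1) by auto
  have "i \<in> A \<longleftrightarrow> i \<le> Max A" for i
    using M assms(2)[OF M(1), of i] by (metis le_less)
  then have "A = {..Max A}" by blast
  then show ?thesis by (metis card_atMost lessThan_Suc_atMost)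
qed simp

text \<open>
  The closure conditions say that every row is an initial segment of the columns and that the
  nonempty rows are the lowest ones; the row lengths then form a composition.
\<close>

lemma ex_composition_height_cells:
  assumes fin: "finite D"
    and pos: "\<And>h j. (h, j) \<in> D \<Longrightarrow> 1 \<le> j"
    and left: "\<And>h j. 1 \<le> j \<Longrightarrow> (h, j + 1) \<in> D \<Longrightarrow> (h, j) \<in> D"
    and down: "\<And>h h'. (h', 1) \<in> D \<Longrightarrow> h < h' \<Longrightarrow> (h, 1) \<in> D"
  shows "\<exists>\<beta>. composition \<beta> \<and> height_cells \<beta> = D"
proof -
  define row where "row h = {j. (h, Suc j) \<in> D}" for h
  define A where "A = {h. (h, 1) \<in> D}"
  have "finite (row h)" for h
  proof -
    have "row h \<subseteq> (\<lambda>p. snd p - 1) ` D" by (force simp: row_def)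
    then show ?thesis using fin finite_subset by blast
  qed
  moreover have dn: "(h, Suc i) \<in> D" if "(h, Suc j) \<in> D" "i \<le> j" for h i j
  proof -
    have "(h, Suc (i + d)) \<in> D \<Longrightarrow> (h, Suc i) \<in> D" for d
    proof (induction d)
      case (Suc d)
      then show ?case using left[of "Suc (i + d)" h] by simp
    qed simp
    from this[of "j - i"] show ?thesis using that by simp
  qed
  ultimately have "row h = {..<card (row h)}" for h
    by (intro initial_segment) (simp_all add: row_def)
  then have row: "i \<in> row h \<longleftrightarrow> i < card (row h)" for h i
    by (metis lessThan_iff)
  have "A \<subseteq> fst ` D" by (force simp: A_def)
  then have "finite A" using fin finite_subset by blast
  then have "A = {..<card A}"
    by (intro initial_segment) (simp_all add: A_def, metis down One_nat_def)
  then have A: "(h, 1) \<in> D \<longleftrightarrow> h < card A" for h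
    by (metis A_def lessThan_iff mem_Collect_eq)
  define \<beta> where "\<beta> = rev (map (\<lambda>h. card (row h)) [0..<card A])"
  have mem: "(h, j) \<in> D \<longleftrightarrow> h < card A \<and> 1 \<le> j \<and> j \<le> card (row h)" for h j
  proof -
    have "h < card A" if "(h, j) \<in> D"
    proof -
      have "(h, 1) \<in> D" using dn[of h "j - 1" 0] that pos[OF that] by simp
      then show ?thesis using A by simp
    qed
    moreover have "(h, j) \<in> D \<longleftrightarrow> 1 \<le> j \<and> j \<le> card (row h)"
    proof (cases j)
      case (Suc i)
      have "(h, j) \<in> D \<longleftrightarrow> i \<in> row h" by (simp add: Suc row_def)
      then show ?thesis using row Suc by auto
    qed (use pos in fastforce)
    ultimately show ?thesis by blast
  qed
  have "height_cells \<beta> = D"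
    by (auto simp: height_cells_def \<beta>_def mem)
  moreover have "composition \<beta>"
  proof -
    have "card (row h) \<noteq> 0" if "h < card A" for h
    proof -
      have "(h, 1) \<in> D" using that A by simp
      then show ?thesis using mem[of h 1] by simp
    qed
    then show ?thesis by (force simp: composition_def \<beta>_def)
  qed
  ultimately show ?thesis by blast
qed


section \<open>Covers as additions of one cell\<close>

lemma covers_at_composition:
  assumes "covers_at \<beta> c \<gamma>" "composition \<beta>"
  shows "composition \<gamma>"
  using assms by (cases rule: covers_at.cases) (auto simp: composition_def)

text \<open>
  A part 0 could grow into column 1, which prepending also does; for a composition the
  column decides which cell is added.
\<close>

lemma covers_at_deterministic:
  assumes "covers_at \<beta> c \<gamma>" "covers_at \<beta> c \<gamma>'" "composition \<beta>"
  shows "\<gamma> = \<gamma>'"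
  using assms(1)
proof cases
  case prepend
  from assms(2) show ?thesis
    by cases (use prepend assms(3) in \<open>auto simp: composition_def\<close>)
next
  case (grow k \<beta>1 \<beta>2)
  from assms(2) show ?thesis
  proof cases
    case (grow k' \<beta>1' \<beta>2')
    have "k' = k" using grow(2) \<open>c = k + 1\<close> by simp
    have "\<beta>1 = takeWhile (\<lambda>x. x \<noteq> k) \<beta>"
      unfolding \<open>\<beta> = \<beta>1 @ _\<close> using \<open>k \<notin> set \<beta>1\<close> by (induction \<beta>1) auto
    moreover have "\<beta>1' = takeWhile (\<lambda>x. x \<noteq> k) \<beta>"
      unfolding \<open>\<beta> = \<beta>1' @ _\<close> using grow(4) unfolding \<open>k' = k\<close> by (induction \<beta>1') auto
    ultimately have "\<beta>1 = \<beta>1'" by simp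
    then have "\<beta>2 = \<beta>2'" using \<open>\<beta> = \<beta>1 @ _\<close> \<open>\<beta> = \<beta>1' @ _\<close> by simp
    then show ?thesis using \<open>\<gamma> = _\<close> \<open>\<gamma>' = _\<close> \<open>\<beta>1 = \<beta>1'\<close> \<open>k' = k\<close> by simp
  qed (use grow assms(3) in \<open>auto simp: composition_def\<close>)
qed

text \<open>
  The last condition is the rule that among the parts of size \<open>c - 1\<close> the leftmost, hence the highest,
  one grows: every higher row that reaches column \<open>c - 1\<close> also reaches column \<open>c\<close>. Column 1 is exempt, since there
  is no column 0; a diagram gains a cell of column 1 only on top of its first column.
\<close>

definition adds_cell :: "nat list \<Rightarrow> nat \<Rightarrow> nat \<Rightarrow> nat list \<Rightarrow> bool" where
  "adds_cell \<beta> h c \<gamma> \<longleftrightarrow> height_cells \<gamma> = insert (h, c) (height_cells \<beta>) \<and> (h, c) \<notin> height_cells \<beta> \<and>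
     (\<forall>h'>h. 1 < c \<longrightarrow> (h', c - 1) \<in> height_cells \<beta> \<longrightarrow> (h', c) \<in> height_cells \<beta>)"

lemma adds_cell_if_covers_at:
  assumes "covers_at \<beta> c \<gamma>" "composition \<beta>"
  shows "\<exists>h. adds_cell \<beta> h c \<gamma>"
  using assms(1)
proof cases
  case prepend
  show ?thesis
  proof (rule exI[of _ "length \<beta>"])
    have "(h, j) \<notin> height_cells \<beta>" if "length \<beta> \<le> h" for h j
      using that by (simp add: height_cells_def)
    then show "adds_cell \<beta> (length \<beta>) c \<gamma>"
      using prepend by (simp add: adds_cell_def height_cells_Cons)
  qed
next
  case (grow k \<beta>1 \<beta>2)
  have app: "(h, j) \<in> height_cells (xs @ ys) \<longleftrightarrow>
      (h, j) \<in> height_cells ys \<or> length ys \<le> h \<and> (h - length ys, j) \<in> height_cells xs" for xs ys h j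
    by (auto simp: height_cells_def nth_append)
  show ?thesis
    unfolding adds_cell_def
  proof (intro exI[of _ "length \<beta>2"] conjI allI impI)
    show "height_cells \<gamma> = insert (length \<beta>2, c) (height_cells \<beta>)" "(length \<beta>2, c) \<notin> height_cells \<beta>"
      unfolding grow set_eq_iff split_paired_All insert_iff app height_cells_Cons
      by (auto simp: height_cells_def)
    fix h' assume h': "length \<beta>2 < h'" "(h', c - 1) \<in> height_cells \<beta>"
    then have *: "h' - Suc (length \<beta>2) < length \<beta>1" "rev \<beta>1 ! (h' - Suc (length \<beta>2)) \<ge> k"
      using grow by (auto simp: height_cells_def nth_append split: if_splits)
    then have "rev \<beta>1 ! (h' - Suc (length \<beta>2)) \<noteq> k"
      using \<open>k \<notin> set \<beta>1\<close> by (metis length_rev nth_mem set_rev)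
    then have "rev \<beta>1 ! (h' - Suc (length \<beta>2)) \<ge> k + 1" using * by simp
    then show "(h', c) \<in> height_cells \<beta>" using grow h' *(1) by (auto simp: height_cells_def nth_append)
  qed
qed

lemma covers_at_if_adds_cell:
  assumes \<beta>: "composition \<beta>" and \<gamma>: "composition \<gamma>" and add: "adds_cell \<beta> h c \<gamma>"
  shows "covers_at \<beta> c \<gamma>"
proof -
  have ins: "height_cells \<gamma> = insert (h, c) (height_cells \<beta>)" "(h, c) \<notin> height_cells \<beta>"
    and top: "\<And>h'. h < h' \<Longrightarrow> 1 < c \<Longrightarrow> (h', c - 1) \<in> height_cells \<beta> \<Longrightarrow> (h', c) \<in> height_cells \<beta>"
    using add by (auto simp: adds_cell_def)
  show ?thesis
  proof (cases "c = 1")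
    case True
    have "h = length \<beta>"
    proof (rule ccontr)
      assume "h \<noteq> length \<beta>"
      moreover have "h \<ge> length \<beta>"
        using ins(2) height_cells_column1[OF \<beta>, of h] True by auto
      moreover have "h < length \<gamma>"
        using height_cells_column1[OF \<gamma>, of h] ins True by auto
      ultimately have "length \<beta> < length \<gamma>" by simp
      then have "(length \<beta>, 1) \<in> height_cells \<gamma>" using height_cells_column1[OF \<gamma>] by blast
      then show False using ins True \<open>h \<noteq> length \<beta>\<close> height_cells_column1[OF \<beta>, of "length \<beta>"] by auto
    qed
    then have "\<gamma> = 1 # \<beta>"
      by (intro composition_eqI) (use \<beta> \<gamma> ins True in \<open>auto simp: composition_def height_cells_Cons\<close>)
    then show ?thesis using True covers_at.prepend by simp
  next
    case False
    have "(h, c) \<in> height_cells \<gamma>" using ins by simp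
    then have c: "1 < c" using False height_cells_pos[of h c \<gamma>] by auto
    have hc: "(h, c - 1) \<in> height_cells \<beta>"
    proof -
      have "(h, c - 1) \<in> height_cells \<gamma>"
        using c by (intro height_cells_left[OF \<open>(h, c) \<in> height_cells \<gamma>\<close>]) auto
      then show ?thesis using ins(1) c by auto
    qed
    then have h: "h < length \<beta>" by (auto simp: height_cells_def)
    then have part: "rev \<beta> ! h = c - 1" using hc ins(2) c by (auto simp: height_cells_def)
    define i where "i = length \<beta> - Suc h"
    have i: "i < length \<beta>" "\<beta> ! i = c - 1" using h part by (auto simp: i_def rev_nth)
    have sp: "\<beta> = take i \<beta> @ (c - 1) # drop (Suc i) \<beta>" using i id_take_nth_drop by metis
    have notin: "c - 1 \<notin> set (take i \<beta>)"
    proof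
      assume "c - 1 \<in> set (take i \<beta>)"
      then obtain l where l: "l < i" "\<beta> ! l = c - 1" by (auto simp: in_set_conv_nth)
      define h' where "h' = length \<beta> - Suc l"
      have "h < h'" "h' < length \<beta>" "rev \<beta> ! h' = c - 1"
        using l i h by (auto simp: h'_def i_def rev_nth)
      moreover from this have "(h', c - 1) \<in> height_cells \<beta>" "(h', c) \<notin> height_cells \<beta>"
        using c by (auto simp: height_cells_def)
      ultimately show False using top[of h'] c by blast
    qed
    have "covers_at \<beta> (c - 1 + 1) (take i \<beta> @ (c - 1 + 1) # drop (Suc i) \<beta>)"
      using covers_at.grow[OF notin, of "drop (Suc i) \<beta>"] sp by simp
    then have cov: "covers_at \<beta> c (take i \<beta> @ c # drop (Suc i) \<beta>)" using c by simp
    from adds_cell_if_covers_at[OF this \<beta>]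
    obtain h2 where "adds_cell \<beta> h2 c (take i \<beta> @ c # drop (Suc i) \<beta>)" ..
    then have h2: "height_cells (take i \<beta> @ c # drop (Suc i) \<beta>) = insert (h2, c) (height_cells \<beta>)"
        "(h2, c) \<notin> height_cells \<beta>"
        "\<And>h'. h2 < h' \<Longrightarrow> 1 < c \<Longrightarrow> (h', c - 1) \<in> height_cells \<beta> \<Longrightarrow> (h', c) \<in> height_cells \<beta>"
      unfolding adds_cell_def by blast+
    have hc2: "(h2, c - 1) \<in> height_cells \<beta>"
    proof -
      have "(h2, c - 1) \<in> height_cells (take i \<beta> @ c # drop (Suc i) \<beta>)"
        by (rule height_cells_left[of h2 c]) (use c h2(1) in \<open>simp_all (no_asm_simp)\<close>)
      then show ?thesis using h2(1) c by auto
    qed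
    then have "h2 = h"
      using top[of h2] h2(2) h2(3)[of h] c ins(2) hc hc2 by (cases h h2 rule: linorder_cases) blast+
    then have "take i \<beta> @ c # drop (Suc i) \<beta> = \<gamma>"
      using h2 ins \<gamma> covers_at_composition[OF cov \<beta>] by (intro composition_eqI) auto
    then show ?thesis using cov by simp
  qed
qed


section \<open>Saturated chains and strips\<close>

lemma saturated_chain_composition:
  "saturated_chain \<beta> cs \<gamma> \<Longrightarrow> composition \<beta> \<Longrightarrow> composition \<gamma>"
  by (induction rule: saturated_chain.induct) (auto intro: covers_at_composition)

lemma saturated_chain_append_iff:
  "saturated_chain \<beta> (cs @ ds) \<gamma> \<longleftrightarrow> (\<exists>\<delta>. saturated_chain \<beta> cs \<delta> \<and> saturated_chain \<delta> ds \<gamma>)"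
proof (induction ds arbitrary: \<gamma> rule: rev_induct)
  case Nil
  have "\<delta> = \<gamma>" if "saturated_chain \<delta> [] \<gamma>" for \<delta>
    using that by cases auto
  then show ?case by (auto intro: saturated_chain.refl)
next
  case (snoc d ds)
  have iff: "saturated_chain \<beta> (xs @ [d]) \<gamma> \<longleftrightarrow> (\<exists>\<delta>. saturated_chain \<beta> xs \<delta> \<and> covers_at \<delta> d \<gamma>)"
    for \<beta> xs
    by (auto elim: saturated_chain.cases intro: saturated_chain.step)
  show ?case using snoc iff[of \<beta> "cs @ ds"] iff[of _ ds] by auto
qed

lemma saturated_chain_deterministic:
  "saturated_chain \<beta> cs \<gamma> \<Longrightarrow> saturated_chain \<beta> cs \<gamma>' \<Longrightarrow> composition \<beta> \<Longrightarrow> \<gamma> = \<gamma>'"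
proof (induction arbitrary: \<gamma>' rule: saturated_chain.induct)
  case (refl \<beta>)
  then show ?case by (auto elim: saturated_chain.cases)
next
  case (step \<beta> cs \<gamma> c \<delta>)
  from step.prems(1) obtain \<epsilon> where \<epsilon>: "saturated_chain \<beta> cs \<epsilon>" "covers_at \<epsilon> c \<gamma>'"
    by cases auto
  then have "\<gamma> = \<epsilon>" using step by blast
  then show ?case
    using covers_at_deterministic[OF step.hyps(2)] \<epsilon> saturated_chain_composition step by blast
qed

lemma le_C_if_saturated_chain: "saturated_chain \<beta> cs \<gamma> \<Longrightarrow> \<beta> \<le>\<^sub>C \<gamma>"
  unfolding le_C_def
proof (induction rule: saturated_chain.induct)
  case (step \<beta> cs \<gamma> c \<delta>)
  then show ?case by (auto intro: rtranclp.rtrancl_into_rtrancl)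
qed simp

definition new_cells :: "nat list \<Rightarrow> nat list \<Rightarrow> (nat \<times> nat) set" where
  "new_cells \<beta> \<gamma> = height_cells \<gamma> - height_cells \<beta>"

lemma finite_new_cells [simp]: "finite (new_cells \<beta> \<gamma>)"
  by (simp add: new_cells_def)

lemma sum_list_new_cells:
  assumes "height_cells \<beta> \<subseteq> height_cells \<gamma>"
  shows "sum_list \<gamma> = sum_list \<beta> + card (new_cells \<beta> \<gamma>)"
proof -
  have "card (new_cells \<beta> \<gamma>) = sum_list \<gamma> - sum_list \<beta>" "sum_list \<beta> \<le> sum_list \<gamma>"
    using assms by (simp_all add: new_cells_def card_Diff_subset card_height_cells card_mono
      flip: card_height_cells)
  then show ?thesis by simp
qed

lemma new_cells_adds_cell:
  assumes "height_cells \<beta> \<subseteq> height_cells \<gamma>" "adds_cell \<gamma> h c \<delta>"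
  shows "new_cells \<beta> \<delta> = insert (h, c) (new_cells \<beta> \<gamma>)"
  using assms by (auto simp: new_cells_def adds_cell_def)

lemma saturated_chain_new_cells:
  "saturated_chain \<beta> cs \<gamma> \<Longrightarrow> composition \<beta> \<Longrightarrow>
     height_cells \<beta> \<subseteq> height_cells \<gamma> \<and> image_mset snd (mset_set (new_cells \<beta> \<gamma>)) = mset cs"
proof (induction rule: saturated_chain.induct)
  case (refl \<beta>)
  then show ?case by (simp add: new_cells_def)
next
  case (step \<beta> cs \<gamma> c \<delta>)
  then have sub: "height_cells \<beta> \<subseteq> height_cells \<gamma>"
    and ms: "image_mset snd (mset_set (new_cells \<beta> \<gamma>)) = mset cs" by blast+
  obtain h where h: "adds_cell \<gamma> h c \<delta>"
    using adds_cell_if_covers_at step saturated_chain_composition by blast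
  then have "(h, c) \<notin> new_cells \<beta> \<gamma>" "height_cells \<beta> \<subseteq> height_cells \<delta>"
    using sub by (auto simp: new_cells_def adds_cell_def)
  then show ?case using ms by (simp add: new_cells_adds_cell[OF sub h])
qed

lemma saturated_chain_columns:
  assumes "saturated_chain \<beta> cs \<gamma>" "composition \<beta>"
  shows "snd ` new_cells \<beta> \<gamma> = set cs" "card (new_cells \<beta> \<gamma>) = length cs"
    "sum_list \<gamma> = sum_list \<beta> + length cs"
proof -
  have ms: "image_mset snd (mset_set (new_cells \<beta> \<gamma>)) = mset cs" and sub: "height_cells \<beta> \<subseteq> height_cells \<gamma>"
    using saturated_chain_new_cells[OF assms] by blast+
  show "snd ` new_cells \<beta> \<gamma> = set cs" using arg_cong[OF ms, of set_mset] by simp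
  show card: "card (new_cells \<beta> \<gamma>) = length cs" using arg_cong[OF ms, of size] by simp
  show "sum_list \<gamma> = sum_list \<beta> + length cs" using sum_list_new_cells[OF sub] card by simp
qed

text \<open>
  The description, without chains, of the skew shapes filled by adding cells from left to right.
  When the cell of column \<open>j\<close> is added to row \<open>h\<close>, all strip cells in earlier columns are already there and no
  other cell of column \<open>j\<close> will follow. So a higher row that reaches column \<open>j - 1\<close> in the end has reached it by then,
  and it must contain column \<open>j\<close> already at the start, as \<open>h\<close> would not be the highest row of length \<open>j - 1\<close> otherwise.
  In column 1 the new cell starts the top row.
\<close>

definition left_right_strip :: "nat list \<Rightarrow> nat list \<Rightarrow> bool" where
  "left_right_strip \<beta> \<gamma> \<longleftrightarrow> height_cells \<beta> \<subseteq> height_cells \<gamma> \<and>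
     (\<forall>h h'. (h, 1) \<in> new_cells \<beta> \<gamma> \<longrightarrow> h < h' \<longrightarrow> (h', 1) \<notin> height_cells \<gamma>) \<and>
     (\<forall>h h' j. 1 < j \<longrightarrow> (h, j) \<in> new_cells \<beta> \<gamma> \<longrightarrow> h < h' \<longrightarrow> (h', j - 1) \<in> height_cells \<gamma> \<longrightarrow> (h', j) \<in> height_cells \<beta>)"

lemma left_right_stripD:
  assumes "left_right_strip \<beta> \<gamma>"
  shows "height_cells \<beta> \<subseteq> height_cells \<gamma>"
    and "(h, 1) \<in> new_cells \<beta> \<gamma> \<Longrightarrow> h < h' \<Longrightarrow> (h', 1) \<notin> height_cells \<gamma>"
    and "1 < j \<Longrightarrow> (h, j) \<in> new_cells \<beta> \<gamma> \<Longrightarrow> h < h' \<Longrightarrow> (h', j - 1) \<in> height_cells \<gamma> \<Longrightarrow> (h', j) \<in> height_cells \<beta>"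
  using assms unfolding left_right_strip_def by blast+

lemma left_right_strip_column_unique:
  assumes strip: "left_right_strip \<beta> \<gamma>" and h: "(h, j) \<in> new_cells \<beta> \<gamma>" and h': "(h', j) \<in> new_cells \<beta> \<gamma>"
  shows "h = h'"
proof -
  have False if "(h, j) \<in> new_cells \<beta> \<gamma>" "(h', j) \<in> new_cells \<beta> \<gamma>" "h < h'" for h h'
  proof (cases "j = 1")
    case True
    then show ?thesis using left_right_stripD(2)[OF strip, of h h'] that by (auto simp: new_cells_def)
  next
    case False
    have \<gamma>: "(h', j) \<in> height_cells \<gamma>" using that by (simp add: new_cells_def)
    then have "1 < j" using False height_cells_pos by fastforce
    moreover have "(h', j - 1) \<in> height_cells \<gamma>"
      by (rule height_cells_left[OF \<gamma>]) (use \<open>1 < j\<close> in auto)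
    ultimately show ?thesis
      using left_right_stripD(3)[OF strip, of j h h'] that by (auto simp: new_cells_def)
  qed
  then show ?thesis using h h' by (metis linorder_neqE_nat)
qed

text \<open>
  The columns in which cells have been added so far are smaller than the next column \<open>c\<close>. Hence
  for the row that grows next, columns \<open>c\<close> and beyond of the higher rows are still those of \<open>\<beta>\<close>.
\<close>

lemma left_right_strip_if_chain:
  "saturated_chain \<beta> cs \<gamma> \<Longrightarrow> composition \<beta> \<Longrightarrow> sorted_wrt (<) cs \<Longrightarrow> left_right_strip \<beta> \<gamma>"
proof (induction rule: saturated_chain.induct)
  case (refl \<beta>)
  then show ?case by (simp add: left_right_strip_def new_cells_def)
next
  case (step \<beta> cs \<gamma> c \<delta>)
  then have strip: "left_right_strip \<beta> \<gamma>" by (simp add: sorted_wrt_append)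
  have col: "j < c" if "(h, j) \<in> new_cells \<beta> \<gamma>" for h j
  proof -
    have "j \<in> set cs" using that saturated_chain_columns(1) step.hyps(1) step.prems(1) by force
    then show ?thesis using step.prems(2) by (simp add: sorted_wrt_append)
  qed
  have \<gamma>: "composition \<gamma>" using saturated_chain_composition step by blast
  then have \<delta>: "composition \<delta>" using covers_at_composition step by blast
  obtain r where r: "adds_cell \<gamma> r c \<delta>"
    using adds_cell_if_covers_at step \<gamma> by blast
  have sub: "height_cells \<beta> \<subseteq> height_cells \<gamma>" using left_right_stripD(1)[OF strip] .
  have new: "new_cells \<beta> \<delta> = insert (r, c) (new_cells \<beta> \<gamma>)" using new_cells_adds_cell[OF sub r] .
  have ins: "height_cells \<delta> = insert (r, c) (height_cells \<gamma>)" "(r, c) \<notin> height_cells \<gamma>" using r by (auto simp: adds_cell_def)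
  show ?case
    unfolding left_right_strip_def
  proof (intro conjI allI impI)
    show "height_cells \<beta> \<subseteq> height_cells \<delta>" using sub ins by blast
  next
    fix h h' assume h: "(h, 1) \<in> new_cells \<beta> \<delta>" "h < h'"
    have c: "c \<noteq> 1" if "(h, 1) \<in> new_cells \<beta> \<gamma>" using col[OF that] by simp
    show "(h', 1) \<notin> height_cells \<delta>"
    proof (cases "(h, 1) \<in> new_cells \<beta> \<gamma>")
      case True
      then show ?thesis using left_right_stripD(2)[OF strip True h(2)] c ins by simp
    next
      case False
      then have "h = r" "c = 1" using h new by auto
      show ?thesis
      proof
        assume "(h', 1) \<in> height_cells \<delta>"
        then have "(h', 1) \<in> height_cells \<gamma>" using ins h \<open>h = r\<close> by auto
        then have "(h, 1) \<in> height_cells \<gamma>" using height_cells_column1[OF \<gamma>] h(2) by auto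
        then show False using ins \<open>h = r\<close> \<open>c = 1\<close> by blast
      qed
    qed
  next
    fix h h' j assume h: "1 < j" "(h, j) \<in> new_cells \<beta> \<delta>" "h < h'" "(h', j - 1) \<in> height_cells \<delta>"
    show "(h', j) \<in> height_cells \<beta>"
    proof (cases "(h, j) \<in> new_cells \<beta> \<gamma>")
      case True
      then have "(h', j - 1) \<in> height_cells \<gamma>" using h(4) ins col[OF True] by auto
      then show ?thesis using left_right_stripD(3)[OF strip h(1) True h(3)] by blast
    next
      case False
      then have "h = r" "j = c" using h new by auto
      moreover from this have "(h', c - 1) \<in> height_cells \<gamma>" using ins h by auto
      ultimately have "(h', c) \<in> height_cells \<gamma>" using r h unfolding adds_cell_def by blast
      then show ?thesis using col[of h' c] \<open>j = c\<close> by (auto simp: new_cells_def)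
    qed
  qed
qed

text \<open>
  The strip cell in the largest column was the last one to be added: it is alone in its column and at
  the end of its row, and what is left after its removal is again such a strip.
\<close>

lemma chain_if_left_right_strip:
  "card (new_cells \<beta> \<gamma>) = n \<Longrightarrow> composition \<beta> \<Longrightarrow> composition \<gamma> \<Longrightarrow> left_right_strip \<beta> \<gamma> \<Longrightarrow>
    \<exists>cs. saturated_chain \<beta> cs \<gamma> \<and> sorted_wrt (<) cs"
proof (induction n arbitrary: \<gamma>)
  case 0
  then have "height_cells \<gamma> = height_cells \<beta>"
    using left_right_stripD(1)[OF 0(4)] by (auto simp: new_cells_def)
  then have "\<gamma> = \<beta>" using 0 composition_eqI by blast
  then show ?case using saturated_chain.refl by fastforce
next
  case (Suc n)
  note strip = \<open>left_right_strip \<beta> \<gamma>\<close>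
  have ne: "new_cells \<beta> \<gamma> \<noteq> {}" using Suc.prems(1) by auto
  \<comment> \<open>the column of the cell that was added last\<close>
  define c where "c = Max (snd ` new_cells \<beta> \<gamma>)"
  have "c \<in> snd ` new_cells \<beta> \<gamma>" unfolding c_def using ne by (intro Max_in) auto
  then obtain r where r: "(r, c) \<in> new_cells \<beta> \<gamma>" by auto
  have le: "j \<le> c" if "(h, j) \<in> new_cells \<beta> \<gamma>" for h j
    unfolding c_def using that by (intro Max_ge) force+
  have lt: "j < c" if "(h, j) \<in> new_cells \<beta> \<gamma>" "(h, j) \<noteq> (r, c)" for h j
    using le[OF that(1)] left_right_strip_column_unique[OF strip r, of h] that by fastforce
  have rc: "(r, c) \<in> height_cells \<gamma>" "(r, c) \<notin> height_cells \<beta>" using r by (auto simp: new_cells_def)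
  have sub: "height_cells \<beta> \<subseteq> height_cells \<gamma>" using left_right_stripD(1)[OF strip] .
  have "\<exists>\<delta>. composition \<delta> \<and> height_cells \<delta> = height_cells \<gamma> - {(r, c)}"
  proof (rule ex_composition_height_cells)
    fix h j assume j: "1 \<le> j" "(h, j + 1) \<in> height_cells \<gamma> - {(r, c)}"
    have "(h, j) \<noteq> (r, c)"
    proof
      assume eq: "(h, j) = (r, c)"
      then have "(h, j + 1) \<in> height_cells \<beta>" using j le[of h "j + 1"] by (auto simp: new_cells_def)
      then have "(h, j) \<in> height_cells \<beta>" by (rule height_cells_left) (use j in auto)
      then show False using eq rc by simp
    qed
    moreover have "(h, j) \<in> height_cells \<gamma>"
      by (rule height_cells_left[of h "j + 1"]) (use j in auto)
    ultimately show "(h, j) \<in> height_cells \<gamma> - {(r, c)}" by simp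
  next
    fix h h' assume h: "(h', 1) \<in> height_cells \<gamma> - {(r, c)}" "h < (h' :: nat)"
    have "(h, 1) \<in> height_cells \<gamma>" using h height_cells_column1[OF Suc.prems(3)] by auto
    moreover have "(h, 1) \<noteq> (r, c)"
      using left_right_stripD(2)[OF strip, of r h'] r h by auto
    ultimately show "(h, 1) \<in> height_cells \<gamma> - {(r, c)}" by simp
  qed (auto dest: height_cells_pos)
  then obtain \<delta> where \<delta>: "composition \<delta>" "height_cells \<delta> = height_cells \<gamma> - {(r, c)}" by blast
  have new: "new_cells \<beta> \<delta> = new_cells \<beta> \<gamma> - {(r, c)}"
    using \<delta> by (auto simp: new_cells_def)
  have "left_right_strip \<beta> \<delta>"
    using strip rc \<delta>(2) unfolding left_right_strip_def new by auto
  moreover have "card (new_cells \<beta> \<delta>) = n" using Suc.prems(1) r new by simp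
  ultimately obtain cs where cs: "saturated_chain \<beta> cs \<delta>" "sorted_wrt (<) cs"
    using Suc.IH[of \<delta>] Suc.prems \<delta>(1) by blast
  have "adds_cell \<delta> r c \<gamma>"
    unfolding adds_cell_def
  proof (intro conjI allI impI)
    fix h' assume h': "r < h'" "1 < c" "(h', c - 1) \<in> height_cells \<delta>"
    then have "(h', c) \<in> height_cells \<beta>"
      using left_right_stripD(3)[OF strip h'(2) r h'(1)] \<delta> by auto
    then show "(h', c) \<in> height_cells \<delta>" using sub \<delta> h' by auto
  qed (use \<delta> rc in auto)
  then have "covers_at \<delta> c \<gamma>"
    using covers_at_if_adds_cell \<delta> Suc.prems by blast
  moreover have "sorted_wrt (<) (cs @ [c])"
  proof -
    have "j < c" if "j \<in> set cs" for j
    proof -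
      have "j \<in> snd ` new_cells \<beta> \<delta>"
        using that saturated_chain_columns(1)[OF cs(1) Suc.prems(2)] by simp
      then show ?thesis using lt new by auto
    qed
    then show ?thesis using cs by (simp add: sorted_wrt_append)
  qed
  ultimately show ?case using saturated_chain.step[OF cs(1)] by blast
qed

text \<open>
  A row that has received a cell in column \<open>j\<close> can only grow into column \<open>j + 1\<close>, which comes too late when the
  columns weakly decrease.
\<close>

lemma weakly_decreasing_chain_rows:
  "saturated_chain \<beta> cs \<gamma> \<Longrightarrow> composition \<beta> \<Longrightarrow> sorted_wrt (\<ge>) cs \<Longrightarrow>
     (h, j) \<in> new_cells \<beta> \<gamma> \<Longrightarrow> (h, j') \<in> new_cells \<beta> \<gamma> \<Longrightarrow> j = j'"
proof (induction arbitrary: j j' rule: saturated_chain.induct)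
  case (refl \<beta>)
  then show ?case by (simp add: new_cells_def)
next
  case (step \<beta> cs \<gamma> c \<delta>)
  have sub: "height_cells \<beta> \<subseteq> height_cells \<gamma>" using saturated_chain_new_cells step by blast
  obtain r where r: "adds_cell \<gamma> r c \<delta>"
    using adds_cell_if_covers_at step saturated_chain_composition by blast
  have new: "new_cells \<beta> \<delta> = insert (r, c) (new_cells \<beta> \<gamma>)" using new_cells_adds_cell[OF sub r] .
  have IH: "j = j'" if "(h, j) \<in> new_cells \<beta> \<gamma>" "(h, j') \<in> new_cells \<beta> \<gamma>" for j j'
    using step that by (simp add: sorted_wrt_append)
  have "(r, j) \<notin> new_cells \<beta> \<gamma>" for j
  proof
    assume j: "(r, j) \<in> new_cells \<beta> \<gamma>"
    then have "j \<in> set cs" using saturated_chain_columns(1)[OF step.hyps(1) step.prems(1)] by force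
    then have "c \<le> j" using step.prems(2) by (simp add: sorted_wrt_append)
    moreover have "(r, c) \<in> height_cells \<delta>" using r by (simp add: adds_cell_def)
    then have "1 \<le> c" by (rule height_cells_pos)
    ultimately have "(r, c) \<in> height_cells \<gamma>"
      using j height_cells_left[of r j \<gamma> c] by (simp add: new_cells_def)
    then show False using r by (simp add: adds_cell_def)
  qed
  then show ?case using step.prems(3,4) IH unfolding new by blast
qed

lemma length_le_if_height_cells_subset:
  assumes "composition \<beta>" "composition \<gamma>" "height_cells \<beta> \<subseteq> height_cells \<gamma>"
  shows "length \<beta> \<le> length \<gamma>"
  using assms height_cells_column1 by (metis linorder_not_less less_irrefl_nat subsetD)

lemma skew_cells_flip:
  assumes "composition \<beta>" "composition \<gamma>" "height_cells \<beta> \<subseteq> height_cells \<gamma>" and ij: "(i, j) \<in> skew_cells \<gamma> \<beta>"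
  shows "(length \<gamma> - i, j) \<in> new_cells \<beta> \<gamma>" "1 \<le> i" "i \<le> length \<gamma>"
proof -
  have len: "length \<beta> \<le> length \<gamma>" using length_le_if_height_cells_subset assms by blast
  have \<gamma>: "(i, j) \<in> cells \<gamma>" using ij by (simp add: skew_cells_def)
  then show i: "1 \<le> i" "i \<le> length \<gamma>" by (auto simp: cells_def)
  have "(length \<gamma> - i, j) \<notin> height_cells \<beta>"
  proof
    assume b: "(length \<gamma> - i, j) \<in> height_cells \<beta>"
    then have lt: "length \<gamma> - i < length \<beta>" by (auto simp: height_cells_def)
    have "(length \<beta> - (length \<gamma> - i), j) \<in> cells \<beta>"
      using b height_cells_conv_cells[OF lt] by simp
    moreover have "length \<beta> - (length \<gamma> - i) + (length \<gamma> - length \<beta>) = i" using lt len i by simp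
    ultimately have "(i, j) \<in> (\<lambda>(i, j). (i + (length \<gamma> - length \<beta>), j)) ` cells \<beta>"
      by force
    then show False using ij by (simp add: skew_cells_def)
  qed
  moreover have "(length \<gamma> - i, j) \<in> height_cells \<gamma>" using \<gamma> by (force simp: height_cells_image)
  ultimately show "(length \<gamma> - i, j) \<in> new_cells \<beta> \<gamma>" by (simp add: new_cells_def)
qed

lemma horizontal_strip_if_left_right_strip:
  assumes "composition \<beta>" "composition \<gamma>" "left_right_strip \<beta> \<gamma>"
  shows "horizontal_strip (skew_cells \<gamma> \<beta>)"
  unfolding horizontal_strip_def
proof (intro allI impI)
  fix i i' j assume i: "(i, j) \<in> skew_cells \<gamma> \<beta>" "(i', j) \<in> skew_cells \<gamma> \<beta>"
  note flip = skew_cells_flip[OF assms(1,2) left_right_stripD(1)[OF assms(3)]]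
  have "length \<gamma> - i = length \<gamma> - i'"
    using left_right_strip_column_unique[OF assms(3)] flip i by blast
  then show "i = i'" using flip(3)[OF i(1)] flip(3)[OF i(2)] by simp
qed

lemma vertical_strip_if_weakly_decreasing_chain:
  assumes "composition \<beta>" "saturated_chain \<beta> cs \<gamma>" "sorted_wrt (\<ge>) cs"
  shows "vertical_strip (skew_cells \<gamma> \<beta>)"
  unfolding vertical_strip_def
  using weakly_decreasing_chain_rows[OF assms(2,1,3)] saturated_chain_new_cells[OF assms(2,1)]
    skew_cells_flip(1)[OF assms(1) saturated_chain_composition[OF assms(2,1)]] by blast

text \<open>
  The multiset of columns of a chain depends only on its end points, and sorting leaves one word.
\<close>

lemma sorted_columns_unique:
  assumes "saturated_chain \<beta> cs \<gamma>" "saturated_chain \<beta> ds \<gamma>" "composition \<beta>"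
  shows "sorted_wrt (<) cs \<Longrightarrow> sorted_wrt (<) ds \<Longrightarrow> cs = ds"
    and "sorted_wrt (\<ge>) cs \<Longrightarrow> sorted_wrt (\<ge>) ds \<Longrightarrow> cs = ds"
proof -
  have ms: "mset cs = mset ds" using saturated_chain_new_cells assms by metis
  show "cs = ds" if "sorted_wrt (<) cs" "sorted_wrt (<) ds"
    using that ms by (metis strict_sorted_iff properties_for_sort)
  show "cs = ds" if "sorted_wrt (\<ge>) cs" "sorted_wrt (\<ge>) ds"
  proof -
    have "sorted (rev cs)" "sorted (rev ds)" using that by (simp_all add: sorted_wrt_rev)
    then show ?thesis using ms by (metis mset_rev properties_for_sort rev_rev_ident)
  qed
qed


section \<open>Tableaux with rows counted from the bottom\<close>

text \<open>
  A filling is extended by 0 outside its diagram. With positive entries inside, the three conditions on tableaux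
  can be stated without reference to the shape: the membership of \<open>(h', j + 1)\<close> in the diagram that
  the triple condition demands follows from a positive entry there.
\<close>

definition valid_filling :: "(nat \<times> nat \<Rightarrow> nat) \<Rightarrow> bool" where
  "valid_filling t \<longleftrightarrow>
     (\<forall>h j. 1 \<le> j \<longrightarrow> t (h, j + 1) \<le> t (h, j)) \<and>
     (\<forall>h h'. h < h' \<longrightarrow> 0 < t (h', 1) \<longrightarrow> t (h', 1) < t (h, 1)) \<and>
     (\<forall>h h' j. h < h' \<longrightarrow> 1 \<le> j \<longrightarrow> 0 < t (h, j + 1) \<longrightarrow> t (h, j + 1) \<le> t (h', j) \<longrightarrow>
        t (h, j + 1) < t (h', j + 1))"

lemma valid_fillingD:
  assumes "valid_filling t"
  shows "1 \<le> j \<Longrightarrow> t (h, j + 1) \<le> t (h, j)"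
    and "h < h' \<Longrightarrow> 0 < t (h', 1) \<Longrightarrow> t (h', 1) < t (h, 1)"
    and "h < h' \<Longrightarrow> 1 \<le> j \<Longrightarrow> 0 < t (h, j + 1) \<Longrightarrow> t (h, j + 1) \<le> t (h', j) \<Longrightarrow> t (h, j + 1) < t (h', j + 1)"
  using assms unfolding valid_filling_def by blast+

definition tableaux :: "nat list \<Rightarrow> (nat \<times> nat \<Rightarrow> nat) set" where
  "tableaux \<gamma> = {t. valid_filling t \<and> {p. 0 < t p} = height_cells \<gamma>}"

text \<open>
  The count starts with the entry 1 because the value 0 marks the cells outside the diagram.
\<close>

definition has_weight :: "(nat \<times> nat \<Rightarrow> nat) \<Rightarrow> nat list \<Rightarrow> bool" where
  "has_weight t \<alpha> \<longleftrightarrow> (\<forall>v. card {p. t p = Suc v} = (if v < length \<alpha> then \<alpha> ! v else 0))"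

definition kostka :: "nat list \<Rightarrow> nat list \<Rightarrow> nat" where
  "kostka \<gamma> \<alpha> = card {t \<in> tableaux \<gamma>. has_weight t \<alpha>}"

lemma all_nat_iff: "(\<forall>v. P v) \<longleftrightarrow> P 0 \<and> (\<forall>v. P (Suc v))"
  by (metis nat.exhaust)

lemma tableaux_pos_iff: "t \<in> tableaux \<gamma> \<Longrightarrow> 0 < t p \<longleftrightarrow> p \<in> height_cells \<gamma>"
  by (auto simp: tableaux_def)

lemma count_canonical_monomial:
  "count (canonical_monomial \<alpha>) v = (if 1 \<le> v \<and> v \<le> length \<alpha> then \<alpha> ! (v - 1) else 0)"
proof -
  have "count (canonical_monomial \<alpha>) v = (\<Sum>i<length \<alpha>. if i + 1 = v then \<alpha> ! i else 0)"
    unfolding canonical_monomial_def count_sum by (intro sum.cong) auto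
  also have "\<dots> = (\<Sum>i<length \<alpha>. if i = v - 1 then (if 1 \<le> v then \<alpha> ! i else 0) else 0)"
    by (intro sum.cong) auto
  finally show ?thesis by (auto simp: sum.delta)
qed

lemma count_content: "count (content \<gamma> T) v = card {c \<in> cells \<gamma>. T c = v}"
proof -
  have "count (content \<gamma> T) v = sum (count (mset_set (cells \<gamma>))) {c \<in> cells \<gamma>. T c = v}"
    unfolding content_def count_image_mset
    by (intro sum.cong) (auto simp: finite_cells)
  also have "\<dots> = (\<Sum>c \<in> {c \<in> cells \<gamma>. T c = v}. 1)"
    by (intro sum.cong) (auto simp: finite_cells count_mset_set)
  finally show ?thesis by simp
qed

lemma sscts_pos_iff:
  assumes "T \<in> sscts \<gamma>"
  shows "0 < T c \<longleftrightarrow> c \<in> cells \<gamma>"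
proof -
  have "\<forall>c. c \<notin> cells \<gamma> \<longrightarrow> T c = 0" "\<forall>c \<in> cells \<gamma>. T c > 0"
    using assms unfolding sscts_def by blast+
  then show ?thesis by (metis less_irrefl_nat)
qed

text \<open>
  From rows counted from the top, starting with 1, to rows counted from the bottom, starting with 0.
\<close>

definition flip :: "nat list \<Rightarrow> (nat \<times> nat \<Rightarrow> nat) \<Rightarrow> nat \<times> nat \<Rightarrow> nat" where
  "flip \<gamma> T = (\<lambda>(h, j). if h < length \<gamma> then T (length \<gamma> - h, j) else 0)"

definition unflip :: "nat list \<Rightarrow> (nat \<times> nat \<Rightarrow> nat) \<Rightarrow> nat \<times> nat \<Rightarrow> nat" where
  "unflip \<gamma> t = (\<lambda>(i, j). if 1 \<le> i \<and> i \<le> length \<gamma> then t (length \<gamma> - i, j) else 0)"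

lemma flip_in_tableaux:
  assumes \<gamma>: "composition \<gamma>" and T: "T \<in> sscts \<gamma>"
  shows "flip \<gamma> T \<in> tableaux \<gamma>"
proof -
  have pos: "0 < T (i, j) \<longleftrightarrow> (i, j) \<in> cells \<gamma>" for i j using sscts_pos_iff[OF T] .
  have supp: "0 < flip \<gamma> T (h, j) \<longleftrightarrow> (h, j) \<in> height_cells \<gamma>" for h j
    using height_cells_conv_cells[of h \<gamma> j] by (auto simp: flip_def pos) (auto simp: height_cells_def)
  have row: "T (i, j + 1) \<le> T (i, j)" if "1 \<le> j" for i j
  proof (cases "(i, j + 1) \<in> cells \<gamma>")
    case True
    then have "(i, j) \<in> cells \<gamma>" using that by (auto simp: cells_def)
    moreover have "j < j + 1" by simp
    ultimately show ?thesis using T True unfolding sscts_def by blast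
  next
    case False
    then show ?thesis using pos[of i "j + 1"] by simp
  qed
  have col: "T (i, 1) < T (i', 1)" if "i < i'" "0 < T (i, 1)" "1 \<le> i" "i' \<le> length \<gamma>" for i i'
  proof -
    have "(i', 1) \<in> cells \<gamma>"
      using \<gamma> that height_cells_column1[OF \<gamma>, of "length \<gamma> - i'"] height_cells_conv_cells[of "length \<gamma> - i'" \<gamma> 1] by simp
    then show ?thesis using T that pos[of i 1] unfolding sscts_def by blast
  qed
  have tri: "T (i', j + 1) < T (i, j + 1)"
    if "i < i'" "1 \<le> j" "0 < T (i', j + 1)" "T (i', j + 1) \<le> T (i, j)" for i i' j
  proof -
    have "0 < T (i, j)" using that by simp
    then show ?thesis using T that pos[of i' "j + 1"] pos[of i j] unfolding sscts_def by blast
  qed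
  have "valid_filling (flip \<gamma> T)"
    unfolding valid_filling_def
  proof (intro conjI allI impI)
    fix h h' assume "(h :: nat) < h'" "0 < flip \<gamma> T (h', 1)"
    then show "flip \<gamma> T (h', 1) < flip \<gamma> T (h, 1)"
      using col[of "length \<gamma> - h'" "length \<gamma> - h"] by (auto simp: flip_def split: if_splits)
  next
    fix h h' j assume "(h :: nat) < h'" "(1 :: nat) \<le> j" "0 < flip \<gamma> T (h, j + 1)"
      "flip \<gamma> T (h, j + 1) \<le> flip \<gamma> T (h', j)"
    then show "flip \<gamma> T (h, j + 1) < flip \<gamma> T (h', j + 1)"
      using tri[of "length \<gamma> - h'" "length \<gamma> - h" j] by (auto simp: flip_def split: if_splits)
  qed (use row in \<open>auto simp: flip_def\<close>)
  then show ?thesis using supp by (auto simp: tableaux_def)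
qed

lemma unflip_in_sscts:
  assumes \<gamma>: "composition \<gamma>" and t: "t \<in> tableaux \<gamma>"
  shows "unflip \<gamma> t \<in> sscts \<gamma>"
proof -
  have valid: "valid_filling t" using t by (simp add: tableaux_def)
  have pos: "0 < unflip \<gamma> t (i, j) \<longleftrightarrow> (i, j) \<in> cells \<gamma>" for i j
  proof (cases "1 \<le> i \<and> i \<le> length \<gamma>")
    case True
    then have "(length \<gamma> - i, j) \<in> height_cells \<gamma> \<longleftrightarrow> (i, j) \<in> cells \<gamma>"
      by (subst height_cells_conv_cells) auto
    then show ?thesis using True by (simp add: unflip_def tableaux_pos_iff[OF t])
  next
    case False
    then show ?thesis by (auto simp: unflip_def cells_def)
  qed
  have row1: "t (h, Suc i + d) \<le> t (h, Suc i)" for h i d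
  proof (induction d)
    case (Suc d)
    then show ?case using valid_fillingD(1)[OF valid, of "Suc i + d" h] by simp
  qed simp
  have row: "t (h, j') \<le> t (h, j)" if "j < j'" "1 \<le> j" for h j j'
    using row1[of h "j - 1" "j' - j"] that by simp
  show ?thesis
    unfolding sscts_def
  proof (intro CollectI conjI allI impI ballI)
    fix c assume "c \<notin> cells \<gamma>"
    then show "unflip \<gamma> t c = 0" using pos by (cases c) auto
  next
    fix c assume "c \<in> cells \<gamma>"
    then show "0 < unflip \<gamma> t c" using pos by (cases c) auto
  next
    fix i j j' assume "(j :: nat) < j'" "(i, j) \<in> cells \<gamma>" "(i, j') \<in> cells \<gamma>"
    then show "unflip \<gamma> t (i, j') \<le> unflip \<gamma> t (i, j)"
      using row by (auto simp: unflip_def cells_def)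
  next
    fix i i' assume i: "(i :: nat) < i'" "(i, 1) \<in> cells \<gamma>" "(i', 1) \<in> cells \<gamma>"
    have "length \<gamma> - i' < length \<gamma> - i" using i by (auto simp: cells_def)
    moreover have "0 < t (length \<gamma> - i, 1)"
      using i(2) pos[of i 1] by (auto simp: unflip_def cells_def)
    ultimately have "t (length \<gamma> - i, 1) < t (length \<gamma> - i', 1)" using valid_fillingD(2)[OF valid] by blast
    then show "unflip \<gamma> t (i, 1) < unflip \<gamma> t (i', 1)" using i by (auto simp: unflip_def cells_def)
  next
    fix i i' j
    assume i: "(i :: nat) < i'" "(i, j) \<in> cells \<gamma>" "(i', j + 1) \<in> cells \<gamma>"
      and le: "unflip \<gamma> t (i', j + 1) \<le> unflip \<gamma> t (i, j)"
    have rng: "1 \<le> i" "i' \<le> length \<gamma>" "1 \<le> j" using i by (auto simp: cells_def)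
    then have "length \<gamma> - i' < length \<gamma> - i" using i(1) by simp
    moreover have "0 < t (length \<gamma> - i', j + 1)" "t (length \<gamma> - i', j + 1) \<le> t (length \<gamma> - i, j)"
      using i pos[of i' "j + 1"] le rng by (auto simp: unflip_def)
    ultimately have "t (length \<gamma> - i', j + 1) < t (length \<gamma> - i, j + 1)"
      using valid_fillingD(3)[OF valid] rng by blast
    then show "unflip \<gamma> t (i', j + 1) < unflip \<gamma> t (i, j + 1)"
      using i(1) rng by (auto simp: unflip_def)
    then show "(i, j + 1) \<in> cells \<gamma>" using pos[of i "j + 1"] by linarith
  qed
qed

lemma unflip_flip:
  assumes "T \<in> sscts \<gamma>" shows "unflip \<gamma> (flip \<gamma> T) = T"
proof
  fix p :: "nat \<times> nat"
  have "0 < T p \<Longrightarrow> 1 \<le> fst p \<and> fst p \<le> length \<gamma>"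
    unfolding sscts_pos_iff[OF assms] by (auto simp: cells_def)
  then show "unflip \<gamma> (flip \<gamma> T) p = T p"
    by (cases p) (auto simp: unflip_def flip_def)
qed

lemma flip_unflip:
  assumes "t \<in> tableaux \<gamma>" shows "flip \<gamma> (unflip \<gamma> t) = t"
proof
  fix p :: "nat \<times> nat"
  have "0 < t p \<Longrightarrow> fst p < length \<gamma>"
    unfolding tableaux_pos_iff[OF assms] by (auto simp: height_cells_def)
  then show "flip \<gamma> (unflip \<gamma> t) p = t p"
    by (cases p; cases "0 < t p") (auto simp: unflip_def flip_def)
qed

text \<open>
  Turning the rows around is a bijection from the cells counted from the top to those counted from the
  bottom, so it preserves the number of occurrences of each entry.
\<close>

lemma content_eq_iff_has_weight_flip:
  assumes T: "T \<in> sscts \<gamma>"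
  shows "content \<gamma> T = canonical_monomial \<alpha> \<longleftrightarrow> has_weight (flip \<gamma> T) \<alpha>"
proof -
  have card: "card {p. flip \<gamma> T p = Suc v} = card {c \<in> cells \<gamma>. T c = Suc v}" for v
  proof -
    have "{p. flip \<gamma> T p = Suc v} = (\<lambda>(i, j). (length \<gamma> - i, j)) ` {c \<in> cells \<gamma>. T c = Suc v}" (is "?L = ?R")
    proof (intro equalityI subsetI)
      fix p assume p: "p \<in> ?L"
      obtain h j where [simp]: "p = (h, j)" by (cases p)
      have h: "h < length \<gamma>" "T (length \<gamma> - h, j) = Suc v"
        using p by (auto simp: flip_def split: if_splits)
      then have "(length \<gamma> - h, j) \<in> cells \<gamma>" using sscts_pos_iff[OF T] by fastforce
      then show "p \<in> ?R" using h by (intro image_eqI[of _ _ "(length \<gamma> - h, j)"]) auto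
    next
      fix p assume "p \<in> ?R"
      then show "p \<in> ?L" by (auto simp: flip_def cells_def)
    qed
    moreover have "inj_on (\<lambda>(i, j). (length \<gamma> - i, j)) {c \<in> cells \<gamma>. T c = Suc v}"
      by (rule inj_on_subset[OF inj_on_flip]) auto
    ultimately show ?thesis by (simp add: card_image)
  qed
  have "T c \<noteq> 0" if "c \<in> cells \<gamma>" for c using sscts_pos_iff[OF T] that by simp
  then have "{c \<in> cells \<gamma>. T c = 0} = {}" by blast
  then have "count (content \<gamma> T) 0 = 0" by (metis card.empty count_content)
  then show ?thesis
    unfolding multiset_eq_iff has_weight_def card count_content[symmetric]
    by (subst all_nat_iff) (simp add: count_canonical_monomial Suc_le_eq)
qed

lemma mcoeff_qschur:
  assumes "composition \<gamma>"
  shows "mcoeff (qschur \<gamma>) \<alpha> = of_nat (kostka \<gamma> \<alpha>)"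
proof -
  have "bij_betw (flip \<gamma>) {T \<in> sscts \<gamma>. content \<gamma> T = canonical_monomial \<alpha>} {t \<in> tableaux \<gamma>. has_weight t \<alpha>}"
    by (rule bij_betw_byWitness[where f' = "unflip \<gamma>"])
      (use assms in \<open>auto simp: unflip_flip flip_unflip content_eq_iff_has_weight_flip flip_in_tableaux unflip_in_sscts\<close>)
  then show ?thesis by (simp add: mcoeff_def qschur.rep_eq kostka_def bij_betw_same_card)
qed


section \<open>Removing the smallest entries of a tableau\<close>

text \<open>
  The shapes that a tableau of shape \<open>\<gamma>\<close> can have after \<open>a\<close> entries 1 have been removed.
\<close>

definition peelings :: "nat \<Rightarrow> nat list \<Rightarrow> nat list set" where
  "peelings a \<gamma> = {\<beta>. composition \<beta> \<and> left_right_strip \<beta> \<gamma> \<and> card (new_cells \<beta> \<gamma>) = a}"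

lemma finite_peelings [simp]: "finite (peelings a \<gamma>)"
proof (rule finite_imageD)
  show "finite (height_cells ` peelings a \<gamma>)"
    by (rule finite_subset[of _ "Pow (height_cells \<gamma>)"]) (auto simp: peelings_def left_right_strip_def)
  show "inj_on height_cells (peelings a \<gamma>)"
    by (auto simp: inj_on_def peelings_def composition_eqI)
qed

lemma finite_tableaux_weight: "finite {t \<in> tableaux \<gamma>. has_weight t \<alpha>}"
proof (rule finite_subset)
  show "finite {t. \<forall>p. (p \<in> height_cells \<gamma> \<longrightarrow> t p \<in> {..length \<alpha>}) \<and> (p \<notin> height_cells \<gamma> \<longrightarrow> t p = 0)}"
    by (intro finite_set_of_finite_funs) auto
  have "t p \<le> length \<alpha>" if "t \<in> tableaux \<gamma>" "has_weight t \<alpha>" for t p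
  proof (rule ccontr)
    assume "\<not> t p \<le> length \<alpha>"
    then obtain v where v: "t p = Suc v" "length \<alpha> \<le> v" by (cases "t p") auto
    have "card {q. t q = Suc v} = 0" using that(2) v by (simp add: has_weight_def)
    moreover have "finite {q. t q = Suc v}"
      by (rule finite_subset[OF _ finite_height_cells[of \<gamma>]]) (use tableaux_pos_iff[OF that(1)] in force)
    ultimately have "{q. t q = Suc v} = {}" by simp
    then show False using v(1) by blast
  qed
  then show "{t \<in> tableaux \<gamma>. has_weight t \<alpha>} \<subseteq>
      {t. \<forall>p. (p \<in> height_cells \<gamma> \<longrightarrow> t p \<in> {..length \<alpha>}) \<and> (p \<notin> height_cells \<gamma> \<longrightarrow> t p = 0)}"
    using tableaux_pos_iff by fastforce
qed

text \<open>
  Truncated subtraction turns the entries 1 into 0, that is, removes their cells.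
\<close>

lemma valid_filling_peel:
  "valid_filling t \<Longrightarrow> valid_filling (\<lambda>p. t p - 1)"
proof -
  assume valid: "valid_filling t"
  show ?thesis
    unfolding valid_filling_def
  proof (intro conjI allI impI)
    fix h h' assume "(h :: nat) < h'" "0 < t (h', 1) - 1"
    then show "t (h', 1) - 1 < t (h, 1) - 1"
      using valid_fillingD(2)[OF valid, of h h'] by simp
  next
    fix h h' j assume j: "(h :: nat) < h'" "(1 :: nat) \<le> j" "0 < t (h, j + 1) - 1"
      "t (h, j + 1) - 1 \<le> t (h', j) - 1"
    then have "0 < t (h, j + 1)" "t (h, j + 1) \<le> t (h', j)" by linarith+
    then show "t (h, j + 1) - 1 < t (h', j + 1) - 1"
      using valid_fillingD(3)[OF valid j(1,2)] j(3) by linarith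
  qed (use valid_fillingD(1)[OF valid] in \<open>simp add: diff_le_mono\<close>)
qed

text \<open>
  The cells with an entry above 1 form a diagram because rows decrease and the first column increases.
  In the columns beyond the first, the triple condition with smaller entry 1 is the defining property of
  a strip added from left to right.
\<close>

lemma shape_of_peel:
  assumes \<gamma>: "composition \<gamma>" and t: "t \<in> tableaux \<gamma>"
  obtains \<beta> where "composition \<beta>" "left_right_strip \<beta> \<gamma>" "(\<lambda>p. t p - 1) \<in> tableaux \<beta>"
    "new_cells \<beta> \<gamma> = {p. t p = 1}"
proof -
  have valid: "valid_filling t" using t by (simp add: tableaux_def)
  note pos = tableaux_pos_iff[OF t]
  have "\<exists>\<beta>. composition \<beta> \<and> height_cells \<beta> = {p. 1 < t p}"
  proof (rule ex_composition_height_cells)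
    show "finite {p. 1 < t p}"
      by (rule finite_subset[OF _ finite_height_cells[of \<gamma>]]) (use pos in force)
    fix h j
    show "1 \<le> j" if "(h, j) \<in> {p. 1 < t p}"
      using that pos[of "(h, j)"] by (intro height_cells_pos[of h j \<gamma>]) simp
    show "(h, j) \<in> {p. 1 < t p}" if "1 \<le> j" "(h, j + 1) \<in> {p. 1 < t p}"
      using valid_fillingD(1)[OF valid that(1), of h] that(2) by simp
  next
    fix h h' assume "(h', 1) \<in> {p. 1 < t p}" "h < (h' :: nat)"
    then show "(h, 1) \<in> {p. 1 < t p}" using valid_fillingD(2)[OF valid, of h h'] by simp
  qed
  then obtain \<beta> where \<beta>: "composition \<beta>" "height_cells \<beta> = {p. 1 < t p}" by blast
  have "p \<in> new_cells \<beta> \<gamma> \<longleftrightarrow> t p = 1" for p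
    unfolding new_cells_def Diff_iff pos[symmetric] \<beta>(2) by auto
  then have new: "new_cells \<beta> \<gamma> = {p. t p = 1}" by blast
  have "left_right_strip \<beta> \<gamma>"
    unfolding left_right_strip_def new
  proof (intro conjI allI impI)
    show "height_cells \<beta> \<subseteq> height_cells \<gamma>" using \<beta> pos by force
  next
    fix h h' assume "(h, 1) \<in> {p. t p = 1}" "h < (h' :: nat)"
    then show "(h', 1) \<notin> height_cells \<gamma>"
      using valid_fillingD(2)[OF valid, of h h'] pos[of "(h', 1)"] by auto
  next
    fix h h' j assume j: "1 < (j :: nat)" "(h, j) \<in> {p. t p = 1}" "h < (h' :: nat)" "(h', j - 1) \<in> height_cells \<gamma>"
    then show "(h', j) \<in> height_cells \<beta>"
      using valid_fillingD(3)[OF valid, of h h' "j - 1"] pos[of "(h', j - 1)"] \<beta> by auto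
  qed
  moreover have "(\<lambda>p. t p - 1) \<in> tableaux \<beta>"
    using valid_filling_peel[OF valid] \<beta> by (auto simp: tableaux_def)
  ultimately show ?thesis using that \<beta>(1) new by blast
qed

text \<open>
  Raising all entries by 1 and writing 1 into the strip undoes the removal. The triple condition has to be
  checked anew only when its smaller entry is one of these 1s, and there it is the defining property
  of the strip.
\<close>

lemma unpeel_in_tableaux:
  assumes \<gamma>: "composition \<gamma>" and strip: "left_right_strip \<beta> \<gamma>" and t: "t \<in> tableaux \<beta>"
  shows "(\<lambda>p. t p + of_bool (p \<in> height_cells \<gamma>)) \<in> tableaux \<gamma>"
proof -
  have valid: "valid_filling t" using t by (simp add: tableaux_def)
  note pos = tableaux_pos_iff[OF t]
  have sub: "height_cells \<beta> \<subseteq> height_cells \<gamma>" using left_right_stripD(1)[OF strip] .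
  let ?t = "\<lambda>p. t p + of_bool (p \<in> height_cells \<gamma>)"
  have supp: "0 < ?t p \<longleftrightarrow> p \<in> height_cells \<gamma>" for p using pos[of p] sub by auto
  have "valid_filling ?t"
    unfolding valid_filling_def
  proof (intro conjI allI impI)
    fix h j assume j: "(1 :: nat) \<le> j"
    have "(h, j) \<in> height_cells \<gamma>" if "(h, j + 1) \<in> height_cells \<gamma>"
      by (rule height_cells_left[OF that]) (use j in auto)
    then show "?t (h, j + 1) \<le> ?t (h, j)"
      using valid_fillingD(1)[OF valid j, of h] by auto
  next
    fix h h' assume h: "(h :: nat) < h'" "0 < ?t (h', 1)"
    then have \<gamma>': "(h', 1) \<in> height_cells \<gamma>" using supp[of "(h', 1)"] by simp
    then have "(h, 1) \<in> height_cells \<gamma>" using height_cells_column1[OF \<gamma>] h by auto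
    moreover have "(h, 1) \<notin> new_cells \<beta> \<gamma>" using left_right_stripD(2)[OF strip _ h(1)] \<gamma>' by blast
    ultimately have "(h, 1) \<in> height_cells \<beta>" by (simp add: new_cells_def)
    then show "?t (h', 1) < ?t (h, 1)"
      using valid_fillingD(2)[OF valid h(1)] pos[of "(h, 1)"] \<gamma>' sub by (cases "t (h', 1)") auto
  next
    fix h h' j
    assume h: "(h :: nat) < h'" "(1 :: nat) \<le> j" "0 < ?t (h, j + 1)" and le: "?t (h, j + 1) \<le> ?t (h', j)"
    have \<gamma>1: "(h, j + 1) \<in> height_cells \<gamma>" "(h', j) \<in> height_cells \<gamma>"
      using h(3) le supp[of "(h, j + 1)"] supp[of "(h', j)"] by linarith+
    show "?t (h, j + 1) < ?t (h', j + 1)"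
    proof (cases "(h, j + 1) \<in> height_cells \<beta>")
      case True
      then have "t (h, j + 1) < t (h', j + 1)"
        using valid_fillingD(3)[OF valid h(1,2)] le \<gamma>1 pos by simp
      moreover from this have "(h', j + 1) \<in> height_cells \<gamma>" using pos[of "(h', j + 1)"] sub by auto
      ultimately show ?thesis using \<gamma>1 by simp
    next
      case False
      then have "(h, j + 1) \<in> new_cells \<beta> \<gamma>" using \<gamma>1 by (simp add: new_cells_def)
      then have "(h', j + 1) \<in> height_cells \<beta>"
        using left_right_stripD(3)[OF strip, of "j + 1" h h'] \<gamma>1 h by simp
      moreover have "t (h, j + 1) = 0" using False pos by blast
      ultimately show ?thesis using pos[of "(h', j + 1)"] sub by auto
    qed
  qed
  then show ?thesis using supp by (simp add: tableaux_def)
qed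

lemma has_weight_peel:
  assumes "\<And>v. t' v = t v - (1 :: nat)"
  shows "has_weight t (a # \<alpha>) \<longleftrightarrow> card {p. t p = 1} = a \<and> has_weight t' \<alpha>"
proof -
  have "{p. t' p = Suc v} = {p. t p = Suc (Suc v)}" for v by (auto simp: assms)
  then show ?thesis
    unfolding has_weight_def by (subst all_nat_iff) simp
qed

text \<open>
  The pair of a shape \<open>\<beta>\<close> and a tableau of this shape determines a tableau of shape \<open>\<gamma>\<close>, and it is recovered
  from it: lower all entries by 1, and read the shape off the support.
\<close>

lemma kostka_Cons:
  assumes \<gamma>: "composition \<gamma>"
  shows "kostka \<gamma> (a # \<alpha>) = (\<Sum>\<beta> \<in> peelings a \<gamma>. kostka \<beta> \<alpha>)"
proof -
  define f where "f = (\<lambda>(\<beta> :: nat list, t :: nat \<times> nat \<Rightarrow> nat) p. t p + of_bool (p \<in> height_cells \<gamma>))"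
  define S where "S = Sigma (peelings a \<gamma>) (\<lambda>\<beta>. {t \<in> tableaux \<beta>. has_weight t \<alpha>})"
  have peel_f: "(\<lambda>p. f (\<beta>, t) p - 1) = t" and new: "{p. f (\<beta>, t) p = 1} = new_cells \<beta> \<gamma>"
    if "(\<beta>, t) \<in> S" for \<beta> t
  proof -
    have t: "t \<in> tableaux \<beta>" and sub: "height_cells \<beta> \<subseteq> height_cells \<gamma>"
      using that by (auto simp: S_def peelings_def left_right_strip_def)
    note pos = tableaux_pos_iff[OF t]
    show "(\<lambda>p. f (\<beta>, t) p - 1) = t"
    proof
      fix p show "f (\<beta>, t) p - 1 = t p" using pos[of p] sub by (auto simp: f_def)
    qed
    have "f (\<beta>, t) p = 1 \<longleftrightarrow> p \<in> new_cells \<beta> \<gamma>" for p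
      using pos[of p] sub by (auto simp: f_def new_cells_def)
    then show "{p. f (\<beta>, t) p = 1} = new_cells \<beta> \<gamma>" by blast
  qed
  have "inj_on f S"
  proof (rule inj_onI, clarify)
    fix \<beta> t \<beta>' t' assume in_S: "(\<beta>, t) \<in> S" "(\<beta>', t') \<in> S" and eq: "f (\<beta>, t) = f (\<beta>', t')"
    then have "t = t'" using peel_f by metis
    moreover have "height_cells \<beta> = height_cells \<beta>'"
      using in_S \<open>t = t'\<close> by (auto simp: S_def tableaux_def)
    then have "\<beta> = \<beta>'" using in_S by (intro composition_eqI) (auto simp: S_def peelings_def)
    ultimately show "\<beta> = \<beta>' \<and> t = t'" by blast
  qed
  moreover have "f ` S = {t \<in> tableaux \<gamma>. has_weight t (a # \<alpha>)}"
  proof (intro equalityI subsetI)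
    fix t assume "t \<in> f ` S"
    then obtain \<beta> t' where t': "(\<beta>, t') \<in> S" "t = f (\<beta>, t')" by auto
    then have "t \<in> tableaux \<gamma>"
      using unpeel_in_tableaux[OF \<gamma>, of \<beta> t'] by (auto simp: S_def peelings_def f_def)
    moreover have "t' p = t p - 1" for p
      using fun_cong[OF peel_f[OF t'(1)], of p] t'(2) by simp
    then have "has_weight t (a # \<alpha>)"
      using has_weight_peel[of t' t a \<alpha>] new[OF t'(1)] t' by (simp add: S_def peelings_def)
    ultimately show "t \<in> {t \<in> tableaux \<gamma>. has_weight t (a # \<alpha>)}" by blast
  next
    fix t assume t: "t \<in> {t \<in> tableaux \<gamma>. has_weight t (a # \<alpha>)}"
    then obtain \<beta> where \<beta>: "composition \<beta>" "left_right_strip \<beta> \<gamma>" "(\<lambda>p. t p - 1) \<in> tableaux \<beta>"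
        "new_cells \<beta> \<gamma> = {p. t p = 1}"
      using shape_of_peel[OF \<gamma>, of t] by blast
    moreover have "card {p. t p = 1} = a \<and> has_weight (\<lambda>p. t p - 1) \<alpha>"
      using t has_weight_peel[of "\<lambda>p. t p - 1" t a \<alpha>] by auto
    ultimately have "(\<beta>, \<lambda>p. t p - 1) \<in> S" by (simp add: S_def peelings_def)
    moreover have "t = f (\<beta>, \<lambda>p. t p - 1)"
    proof
      fix p show "t p = f (\<beta>, \<lambda>p. t p - 1) p"
        using t tableaux_pos_iff[of t \<gamma> p] by (auto simp: f_def)
    qed
    ultimately show "t \<in> f ` S" by blast
  qed
  ultimately have "kostka \<gamma> (a # \<alpha>) = card S"
    unfolding kostka_def by (metis card_image)
  also have "\<dots> = (\<Sum>\<beta> \<in> peelings a \<gamma>. kostka \<beta> \<alpha>)"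
    unfolding S_def kostka_def by (intro card_SigmaI) (simp_all add: finite_tableaux_weight)
  finally show ?thesis .
qed

lemma kostka_Nil:
  assumes "composition \<gamma>"
  shows "kostka \<gamma> [] = (if \<gamma> = [] then 1 else 0)"
proof -
  have zero: "t = (\<lambda>_. 0)" if "t \<in> tableaux \<gamma>" "has_weight t []" for t
  proof
    fix p
    have "finite {q. t q = t p}" if "0 < t p"
      by (rule finite_subset[OF _ finite_height_cells[of \<gamma>]])
        (use tableaux_pos_iff[OF \<open>t \<in> tableaux \<gamma>\<close>] that in force)
    moreover have "card {q. t q = t p} = 0" if "0 < t p"
      using \<open>has_weight t []\<close> that by (cases "t p") (auto simp: has_weight_def)
    ultimately have "0 < t p \<Longrightarrow> {q. t q = t p} = {}" by simp
    then show "t p = 0" by blast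
  qed
  show ?thesis
  proof (cases "\<gamma> = []")
    case True
    have "{t \<in> tableaux \<gamma>. has_weight t []} = {\<lambda>_. 0}"
      using zero True by (auto simp: tableaux_def has_weight_def valid_filling_def)
    then show ?thesis using True by (simp add: kostka_def)
  next
    case False
    then have "(0, 1) \<in> height_cells \<gamma>" using height_cells_column1[OF assms] by simp
    then have "{t \<in> tableaux \<gamma>. has_weight t []} = {}"
      using zero tableaux_pos_iff by fastforce
    then have "kostka \<gamma> [] = 0" unfolding kostka_def by (metis card.empty)
    then show ?thesis using False by simp
  qed
qed


section \<open>Unitriangularity\<close>

text \<open>
  Among all compositions that arise from \<open>\<beta>\<close> when \<open>a > 0\<close> cells are added from left to right, the one with a
  new part \<open>a\<close> on top of \<open>\<beta>\<close> is the only one with the largest statistic.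
\<close>

definition height_stat :: "nat list \<Rightarrow> nat" where
  "height_stat \<beta> = sum fst (height_cells \<beta>)"

lemma height_stat_Cons: "height_stat (a # \<beta>) = height_stat \<beta> + a * length \<beta>"
proof -
  have "height_cells \<beta> \<inter> {length \<beta>} \<times> {1..a} = {}" by (auto simp: height_cells_def)
  then have "height_stat (a # \<beta>) = height_stat \<beta> + sum fst ({length \<beta>} \<times> {1..a})"
    unfolding height_stat_def height_cells_Cons by (intro sum.union_disjoint) simp_all
  also have "sum fst ({length \<beta>} \<times> {1..a}) = (\<Sum>p \<in> {length \<beta>} \<times> {1..a}. length \<beta>)"
    by (intro sum.cong) auto
  finally show ?thesis by (simp add: card_cartesian_product)
qed

lemma height_stat_le:
  assumes "composition \<beta>"
  shows "height_stat \<beta> \<le> sum_list \<beta> * sum_list \<beta>"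
proof -
  have "height_stat \<beta> \<le> (\<Sum>p \<in> height_cells \<beta>. length \<beta>)"
    unfolding height_stat_def by (intro sum_mono) (auto simp: height_cells_def)
  also have "\<dots> = sum_list \<beta> * length \<beta>" by (simp add: card_height_cells)
  also have "\<dots> \<le> sum_list \<beta> * sum_list \<beta>" using length_le_sum_list[OF assms] by simp
  finally show ?thesis .
qed

lemma left_right_strip_length:
  assumes "composition \<beta>" "composition \<gamma>" and strip: "left_right_strip \<beta> \<gamma>"
  shows "length \<gamma> \<le> length \<beta> + 1"
proof (rule ccontr)
  assume "\<not> ?thesis"
  then have "(length \<beta>, 1) \<in> new_cells \<beta> \<gamma>" "(length \<beta> + 1, 1) \<in> new_cells \<beta> \<gamma>"
    unfolding new_cells_def Diff_iff height_cells_column1[OF assms(1)] height_cells_column1[OF assms(2)]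
    by simp_all
  then have "length \<beta> = length \<beta> + 1" by (rule left_right_strip_column_unique[OF strip])
  then show False by simp
qed

lemma new_cells_height:
  assumes "composition \<beta>" "composition \<gamma>" and strip: "left_right_strip \<beta> \<gamma>"
    and "(h, j) \<in> new_cells \<beta> \<gamma>"
  shows "h \<le> length \<beta>"
proof -
  have "h < length \<gamma>" using assms(4) by (auto simp: new_cells_def height_cells_def)
  then show ?thesis using left_right_strip_length[OF assms(1-3)] by simp
qed

text \<open>
  A strip adds at most one new row, at height \<open>length \<beta>\<close>; none of its cells lies higher, and if the bound is
  attained then all of them lie in that row.
\<close>

lemma height_stat_strip:
  assumes \<beta>: "composition \<beta>" and \<gamma>: "composition \<gamma>" and strip: "left_right_strip \<beta> \<gamma>"
    and card: "card (new_cells \<beta> \<gamma>) = a"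
  shows "height_stat \<gamma> \<le> height_stat (a # \<beta>)"
    and "a > 0 \<Longrightarrow> height_stat \<gamma> = height_stat (a # \<beta>) \<Longrightarrow> \<gamma> = a # \<beta>"
proof -
  have sub: "height_cells \<beta> \<subseteq> height_cells \<gamma>" using left_right_stripD(1)[OF strip] .
  then have un: "height_cells \<gamma> = height_cells \<beta> \<union> new_cells \<beta> \<gamma>" by (auto simp: new_cells_def)
  have stat: "height_stat \<gamma> = height_stat \<beta> + sum fst (new_cells \<beta> \<gamma>)"
    unfolding height_stat_def by (subst un, intro sum.union_disjoint) (auto simp: new_cells_def)
  have le: "fst p \<le> length \<beta>" if "p \<in> new_cells \<beta> \<gamma>" for p
    using new_cells_height[OF \<beta> \<gamma> strip, of "fst p" "snd p"] that by simp
  have "sum fst (new_cells \<beta> \<gamma>) \<le> (\<Sum>p \<in> new_cells \<beta> \<gamma>. length \<beta>)"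
    using le by (intro sum_mono) simp
  then show "height_stat \<gamma> \<le> height_stat (a # \<beta>)" using card by (simp add: stat height_stat_Cons)
  assume "a > 0" and eq: "height_stat \<gamma> = height_stat (a # \<beta>)"
  have row: "fst p = length \<beta>" if p: "p \<in> new_cells \<beta> \<gamma>" for p
  proof (rule ccontr)
    assume "fst p \<noteq> length \<beta>"
    then have "fst p < length \<beta>" using le[OF p] by simp
    then have "sum fst (new_cells \<beta> \<gamma>) < (\<Sum>p \<in> new_cells \<beta> \<gamma>. length \<beta>)"
      using le p by (intro sum_strict_mono_ex1) auto
    then show False using eq card by (simp add: stat height_stat_Cons)
  qed
  let ?J = "{j. (length \<beta>, j) \<in> height_cells \<gamma>}"
  have "(length \<beta>, j) \<notin> height_cells \<beta>" for j by (simp add: height_cells_def)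
  then have "p \<in> new_cells \<beta> \<gamma> \<longleftrightarrow> p \<in> {length \<beta>} \<times> ?J" for p
    using row[of p] by (cases p) (auto simp: new_cells_def)
  then have new: "new_cells \<beta> \<gamma> = {length \<beta>} \<times> ?J" by blast
  then have "card ?J = a" using card by (simp add: card_cartesian_product)
  then have "rev \<gamma> ! length \<beta> = a" "length \<beta> < length \<gamma>"
    using card_row[of "length \<beta>" \<gamma>] \<open>a > 0\<close> by (auto split: if_splits)
  then have J: "?J = {1..a}" by (auto simp: height_cells_def)
  have "height_cells \<gamma> = height_cells (a # \<beta>)"
    by (subst un) (simp only: new J height_cells_Cons)
  then show "\<gamma> = a # \<beta>"
    using \<beta> \<gamma> \<open>a > 0\<close> by (intro composition_eqI) (auto simp: composition_def)
qed

lemma left_right_strip_Cons: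
  assumes "a > 0" "composition \<beta>"
  shows "left_right_strip \<beta> (a # \<beta>)" "card (new_cells \<beta> (a # \<beta>)) = a"
proof -
  have "(length \<beta>, j) \<notin> height_cells \<beta>" for j by (simp add: height_cells_def)
  then have new: "new_cells \<beta> (a # \<beta>) = {length \<beta>} \<times> {1..a}"
    by (auto simp: new_cells_def height_cells_Cons)
  then show "card (new_cells \<beta> (a # \<beta>)) = a" by (simp add: card_cartesian_product)
  have "(h', j) \<notin> height_cells (a # \<beta>)" if "length \<beta> < h'" for h' j
    using that by (simp add: height_cells_def)
  then show "left_right_strip \<beta> (a # \<beta>)"
    unfolding left_right_strip_def new by (auto simp: height_cells_Cons)
qed

text \<open>
  The bound on the length keeps the induction going: the cells of the next strip lie at height at most \<open>length \<beta>\<close>, and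
  they must not lie higher than a new top row of \<open>\<alpha>\<close>.
\<close>

lemma kostka_nonzero:
  "composition \<gamma> \<Longrightarrow> composition \<alpha> \<Longrightarrow> kostka \<gamma> \<alpha> \<noteq> 0 \<Longrightarrow>
     sum_list \<gamma> = sum_list \<alpha> \<and> length \<gamma> \<le> length \<alpha> \<and> (\<gamma> = \<alpha> \<or> height_stat \<gamma> < height_stat \<alpha>)"
proof (induction \<alpha> arbitrary: \<gamma>)
  case Nil
  then show ?case by (simp add: kostka_Nil split: if_splits)
next
  case (Cons a \<alpha>)
  have a: "a > 0" and \<alpha>: "composition \<alpha>" using Cons.prems by (auto simp: composition_def)
  from Cons.prems obtain \<beta> where \<beta>: "\<beta> \<in> peelings a \<gamma>" "kostka \<beta> \<alpha> \<noteq> 0"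
    by (auto simp: kostka_Cons)
  then have comp: "composition \<beta>" and strip: "left_right_strip \<beta> \<gamma>" and card: "card (new_cells \<beta> \<gamma>) = a"
    by (auto simp: peelings_def)
  have IH: "sum_list \<beta> = sum_list \<alpha>" "length \<beta> \<le> length \<alpha>" "\<beta> = \<alpha> \<or> height_stat \<beta> < height_stat \<alpha>"
    using Cons.IH[OF comp \<alpha> \<beta>(2)] by blast+
  have "sum_list \<gamma> = sum_list (a # \<alpha>)"
    using sum_list_new_cells[OF left_right_stripD(1)[OF strip]] card IH by simp
  moreover have "length \<gamma> \<le> length (a # \<alpha>)"
    using left_right_strip_length[OF comp Cons.prems(1) strip] IH by simp
  moreover have "\<gamma> = a # \<alpha> \<or> height_stat \<gamma> < height_stat (a # \<alpha>)"
  proof (cases "\<beta> = \<alpha>")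
    case True
    then show ?thesis using height_stat_strip[OF comp Cons.prems(1) strip card] a by fastforce
  next
    case False
    have "height_stat (a # \<beta>) < height_stat (a # \<alpha>)"
      unfolding height_stat_Cons using IH False by (intro add_less_le_mono) auto
    then show ?thesis using height_stat_strip(1)[OF comp Cons.prems(1) strip card] by linarith
  qed
  ultimately show ?case by blast
qed

lemma kostka_diag: "composition \<alpha> \<Longrightarrow> kostka \<alpha> \<alpha> = 1"
proof (induction \<alpha>)
  case Nil
  then show ?case by (simp add: kostka_Nil)
next
  case (Cons a \<alpha>)
  have a: "a > 0" and \<alpha>: "composition \<alpha>" using Cons.prems by (auto simp: composition_def)
  have in_peelings: "\<alpha> \<in> peelings a (a # \<alpha>)"
    using left_right_strip_Cons[OF a \<alpha>] \<alpha> by (simp add: peelings_def)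
  have "kostka \<beta> \<alpha> = 0" if "\<beta> \<in> peelings a (a # \<alpha>)" "\<beta> \<noteq> \<alpha>" for \<beta>
  proof (rule ccontr)
    assume nz: "kostka \<beta> \<alpha> \<noteq> 0"
    have \<beta>: "composition \<beta>" "left_right_strip \<beta> (a # \<alpha>)" "card (new_cells \<beta> (a # \<alpha>)) = a"
      using that by (auto simp: peelings_def)
    have "height_stat \<beta> < height_stat \<alpha>" "length \<beta> \<le> length \<alpha>"
      using kostka_nonzero[OF \<beta>(1) \<alpha> nz] that by auto
    then have "height_stat (a # \<beta>) < height_stat (a # \<alpha>)"
      unfolding height_stat_Cons by (intro add_less_le_mono) auto
    then show False using height_stat_strip(1)[OF \<beta>(1) Cons.prems \<beta>(2,3)] by simp
  qed
  then have "kostka (a # \<alpha>) (a # \<alpha>) = (\<Sum>\<beta> \<in> {\<alpha>}. kostka \<beta> \<alpha>)"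
    unfolding kostka_Cons[OF Cons.prems] using in_peelings by (intro sum.mono_neutral_right) auto
  then show ?case using Cons.IH[OF \<alpha>] by simp
qed


section \<open>Coordinates in the monomial basis\<close>

lemma finite_compositions: "finite {\<alpha>. composition \<alpha> \<and> sum_list \<alpha> = n}"
proof (rule finite_subset)
  show "{\<alpha>. composition \<alpha> \<and> sum_list \<alpha> = n} \<subseteq> {\<alpha>. set \<alpha> \<subseteq> {..n} \<and> length \<alpha> \<le> n}"
    using member_le_sum_list length_le_sum_list by fastforce
  show "finite {\<alpha> :: nat list. set \<alpha> \<subseteq> {..n} \<and> length \<alpha> \<le> n}"
    by (rule finite_lists_length_le) simp
qed

lemma composition_Cons: "composition (a # \<alpha>) \<longleftrightarrow> 0 < a \<and> composition \<alpha>"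
  by (auto simp: composition_def)

lemma composition_Nil [simp]: "composition []"
  by (simp add: composition_def)

lemma composition_take: "composition \<alpha> \<Longrightarrow> composition (take k \<alpha>)"
  unfolding composition_def by (meson in_set_takeD)

lemma composition_drop: "composition \<alpha> \<Longrightarrow> composition (drop k \<alpha>)"
  unfolding composition_def by (meson in_set_dropD)

lemma exponents_canonical_monomial:
  assumes "composition \<alpha>"
  shows "exponents (canonical_monomial \<alpha>) = \<alpha>"
proof -
  have pos: "0 < \<alpha> ! i" if "i < length \<alpha>" for i
    using assms that by (metis composition_def gr0I nth_mem)
  have "v \<in># canonical_monomial \<alpha> \<longleftrightarrow> v \<in> {1..<Suc (length \<alpha>)}" for v
    unfolding count_greater_zero_iff[symmetric] count_canonical_monomial
    using pos[of "v - 1"] by (auto simp: less_Suc_eq_le)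
  then have "set_mset (canonical_monomial \<alpha>) = {1..<Suc (length \<alpha>)}" by blast
  then have "exponents (canonical_monomial \<alpha>) = map (count (canonical_monomial \<alpha>)) [1..<Suc (length \<alpha>)]"
    by (simp add: exponents_def del: upt_Suc)
  also have "\<dots> = \<alpha>"
    by (rule nth_equalityI) (simp_all add: count_canonical_monomial del: upt_Suc)
  finally show ?thesis .
qed

lemma zero_notin_canonical_monomial: "0 \<notin># canonical_monomial \<alpha>"
  unfolding count_greater_zero_iff[symmetric] count_canonical_monomial by simp

lemma mcoeff_monomial_qsym:
  "composition \<beta> \<Longrightarrow> mcoeff (monomial_qsym \<alpha>) \<beta> = of_bool (\<beta> = \<alpha>)"
  by (simp add: mcoeff_def monomial_qsym.rep_eq zero_notin_canonical_monomial exponents_canonical_monomial)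

text \<open>
  By quasisymmetry each coefficient equals that of the monomial in the first variables with the same
  exponent composition.
\<close>

lemma qsym_eqI:
  assumes "\<And>\<alpha>. composition \<alpha> \<Longrightarrow> mcoeff F \<alpha> = mcoeff G \<alpha>"
  shows "F = G"
proof -
  have "qcoeff F m = qcoeff G m" for m
  proof (cases "0 \<in># m")
    case True
    then show ?thesis using quasisymmetricD(1) qcoeff by (metis mem_Collect_eq)
  next
    case False
    have \<alpha>: "composition (exponents m)"
      unfolding composition_def exponents_def by (auto simp: count_eq_zero_iff)
    have "qcoeff F m = mcoeff F (exponents m)" for F
      unfolding mcoeff_def
      using quasisymmetricD(3)[of "qcoeff F" m "canonical_monomial (exponents m)"] qcoeff[of F] False
      by (simp add: zero_notin_canonical_monomial exponents_canonical_monomial[OF \<alpha>])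
    then show ?thesis using assms[OF \<alpha>] by simp
  qed
  then show ?thesis by (simp add: qcoeff_inject[symmetric] fun_eq_iff)
qed

lemma mcoeff_zero [simp]: "mcoeff 0 \<alpha> = 0"
  by (simp add: mcoeff_def zero_qsym.rep_eq)

lemma mcoeff_add [simp]: "mcoeff (F + G) \<alpha> = mcoeff F \<alpha> + mcoeff G \<alpha>"
  by (simp add: mcoeff_def plus_qsym.rep_eq)

lemma mcoeff_scale [simp]: "mcoeff (qscale c F) \<alpha> = c * mcoeff F \<alpha>"
  by (simp add: mcoeff_def qscale.rep_eq)

lemma mcoeff_sum [simp]: "mcoeff (\<Sum>i\<in>A. F i) \<alpha> = (\<Sum>i\<in>A. mcoeff (F i) \<alpha>)"
  by (induction A rule: infinite_finite_induct) simp_all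

lemma sum_msupp_delta:
  assumes "composition \<beta>"
  shows "(\<Sum>\<alpha> \<in> msupp F. mcoeff F \<alpha> * of_bool (\<alpha> = \<beta>)) = mcoeff F \<beta>"
proof -
  have "(\<Sum>\<alpha> \<in> msupp F. mcoeff F \<alpha> * of_bool (\<alpha> = \<beta>)) = (\<Sum>\<alpha> \<in> msupp F. if \<alpha> = \<beta> then mcoeff F \<beta> else 0)"
    by (intro sum.cong) auto
  also have "\<dots> = (if \<beta> \<in> msupp F then mcoeff F \<beta> else 0)"
    by (rule sum.delta[OF finite_msupp])
  finally show ?thesis using assms by (simp add: msupp_def)
qed

lemma monomial_expansion: "F = (\<Sum>\<alpha> \<in> msupp F. qscale (mcoeff F \<alpha>) (monomial_qsym \<alpha>))"
proof (rule qsym_eqI)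
  fix \<beta> assume \<beta>: "composition \<beta>"
  show "mcoeff F \<beta> = mcoeff (\<Sum>\<alpha> \<in> msupp F. qscale (mcoeff F \<alpha>) (monomial_qsym \<alpha>)) \<beta>"
    using sum_msupp_delta[OF \<beta>, of F] \<beta> by (simp add: mcoeff_monomial_qsym eq_commute[of \<beta>])
qed

lemma graded_functional_functional: "graded_functional (functional x)"
  using functional by simp

lemma functional_add [simp]: "functional x (F + G) = functional x F + functional x G"
  and functional_scale [simp]: "functional x (qscale c F) = c * functional x F"
  using graded_functional_functional[of x] unfolding graded_functional_def linear_qsym_iff by blast+

lemma functional_zero [simp]: "functional x 0 = 0"
  using functional_add[of x 0 0] by simp

lemma functional_sum [simp]: "functional x (\<Sum>i\<in>A. F i) = (\<Sum>i\<in>A. functional x (F i))"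
  by (induction A rule: infinite_finite_induct) simp_all

lemma functional_expansion:
  "functional x F = (\<Sum>\<alpha> \<in> msupp F. mcoeff F \<alpha> * functional x (monomial_qsym \<alpha>))"
  by (subst monomial_expansion[of F]) simp

lemma nsym_eqI_monomial:
  assumes "\<And>\<alpha>. composition \<alpha> \<Longrightarrow> functional x (monomial_qsym \<alpha>) = functional y (monomial_qsym \<alpha>)"
  shows "x = y"
proof -
  have "functional x F = functional y F" for F
    unfolding functional_expansion[of _ F] using assms by (intro sum.cong) (auto simp: msupp_def)
  then show ?thesis by (simp add: functional_inject[symmetric] fun_eq_iff)
qed

text \<open>
  The functional with prescribed values on the monomial basis; it belongs to \<open>NSym\<close> if these values
  vanish for all compositions of large size.
\<close>

definition of_coordinates :: "(nat list \<Rightarrow> rat) \<Rightarrow> nsym" where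
  "of_coordinates X = Abs_nsym (\<lambda>F. \<Sum>\<alpha> \<in> msupp F. mcoeff F \<alpha> * X \<alpha>)"

lemma functional_of_coordinates:
  assumes bound: "\<And>\<alpha>. composition \<alpha> \<Longrightarrow> d < sum_list \<alpha> \<Longrightarrow> X \<alpha> = 0"
  shows "functional (of_coordinates X) F = (\<Sum>\<alpha> \<in> msupp F. mcoeff F \<alpha> * X \<alpha>)"
proof -
  let ?x = "\<lambda>F. \<Sum>\<alpha> \<in> msupp F. mcoeff F \<alpha> * X \<alpha>"
  have superset: "?x F = (\<Sum>\<alpha> \<in> S. mcoeff F \<alpha> * X \<alpha>)"
    if "finite S" "msupp F \<subseteq> S" "\<And>\<alpha>. \<alpha> \<in> S \<Longrightarrow> composition \<alpha>" for S F
    using that by (intro sum.mono_neutral_left) (auto simp: msupp_def)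
  have add: "?x (F + G) = ?x F + ?x G" for F G
  proof -
    have S: "finite (msupp F \<union> msupp G)" "msupp (F + G) \<subseteq> msupp F \<union> msupp G"
      "\<And>\<alpha>. \<alpha> \<in> msupp F \<union> msupp G \<Longrightarrow> composition \<alpha>"
      by (simp_all add: finite_msupp) (auto simp: msupp_def)
    have F: "msupp F \<subseteq> msupp F \<union> msupp G" and G: "msupp G \<subseteq> msupp F \<union> msupp G" by auto
    have "?x (F + G) = (\<Sum>\<alpha> \<in> msupp F \<union> msupp G. mcoeff F \<alpha> * X \<alpha> + mcoeff G \<alpha> * X \<alpha>)"
      by (subst superset[OF S]) (simp_all add: algebra_simps)
    also have "\<dots> = ?x F + ?x G"
      unfolding sum.distrib using superset[OF S(1) F S(3)] superset[OF S(1) G S(3)] by simp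
    finally show ?thesis .
  qed
  have scale: "?x (qscale c F) = c * ?x F" for c F
  proof -
    have S: "finite (msupp F)" "msupp (qscale c F) \<subseteq> msupp F" "\<And>\<alpha>. \<alpha> \<in> msupp F \<Longrightarrow> composition \<alpha>"
      by (simp_all add: finite_msupp) (auto simp: msupp_def)
    show ?thesis by (subst superset[OF S]) (simp_all add: sum_distrib_left algebra_simps)
  qed
  have "?x F = 0" if "d < k" "homogeneous k F" for k F
  proof (rule sum.neutral, rule ballI)
    fix \<alpha> assume \<alpha>: "\<alpha> \<in> msupp F"
    then have "sum_list \<alpha> = k"
      using that(2) by (auto simp: msupp_def mcoeff_def homogeneous_def size_canonical_monomial[symmetric])
    then show "mcoeff F \<alpha> * X \<alpha> = 0" using bound[of \<alpha>] \<alpha> that(1) by (simp add: msupp_def)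
  qed
  then have "graded_functional ?x"
    unfolding graded_functional_def linear_qsym_iff using add scale by blast
  then show ?thesis by (simp add: of_coordinates_def Abs_nsym_inverse)
qed

lemma msupp_monomial_qsym: "composition \<alpha> \<Longrightarrow> msupp (monomial_qsym \<alpha>) = {\<alpha>}"
  by (auto simp: msupp_def mcoeff_monomial_qsym)

lemma functional_of_coordinates_monomial:
  assumes "\<And>\<alpha>. composition \<alpha> \<Longrightarrow> d < sum_list \<alpha> \<Longrightarrow> X \<alpha> = 0" "composition \<alpha>"
  shows "functional (of_coordinates X) (monomial_qsym \<alpha>) = X \<alpha>"
  by (subst functional_of_coordinates[of d X])
    (use assms in \<open>simp_all add: msupp_monomial_qsym mcoeff_monomial_qsym\<close>)

text \<open>
  The coproduct of \<open>M\<^sub>\<alpha>\<close> is the sum over all ways to cut \<open>\<alpha>\<close> into a prefix and a suffix.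
\<close>

lemma functional_times_monomial:
  assumes \<alpha>: "composition \<alpha>"
  shows "functional (x * y) (monomial_qsym \<alpha>) =
    (\<Sum>k\<le>length \<alpha>. functional x (monomial_qsym (take k \<alpha>)) * functional y (monomial_qsym (drop k \<alpha>)))"
proof -
  let ?S = "(\<lambda>k. (take k \<alpha>, drop k \<alpha>)) ` {..length \<alpha>}"
  have inj: "inj_on (\<lambda>k. (take k \<alpha>, drop k \<alpha>)) {..length \<alpha>}"
    by (rule inj_onI) (metis atMost_iff length_take min.absorb2 prod.inject)
  have lookup: "Poly_Mapping.lookup (coproduct (monomial_qsym \<alpha>)) (\<beta>, \<gamma>) = of_bool (\<beta> @ \<gamma> = \<alpha>)" for \<beta> \<gamma>
    using \<alpha> by (auto simp: lookup_coproduct mcoeff_monomial_qsym)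
  have keys: "Poly_Mapping.keys (coproduct (monomial_qsym \<alpha>)) \<subseteq> ?S"
  proof clarify
    fix \<beta> \<gamma> assume "(\<beta>, \<gamma>) \<in> Poly_Mapping.keys (coproduct (monomial_qsym \<alpha>))"
    then have "\<beta> @ \<gamma> = \<alpha>" by (simp add: in_keys_iff lookup)
    then show "(\<beta>, \<gamma>) \<in> ?S" by (intro image_eqI[of _ _ "length \<beta>"]) auto
  qed
  have "functional (x * y) (monomial_qsym \<alpha>) =
      tensor_pairing (coproduct (monomial_qsym \<alpha>)) (functional x) (functional y)"
    by (simp add: times_nsym.rep_eq)
  also have "\<dots> = (\<Sum>(\<beta>, \<gamma>) \<in> ?S. of_bool (\<beta> @ \<gamma> = \<alpha>) *
      (functional x (monomial_qsym \<beta>) * functional y (monomial_qsym \<gamma>)))"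
    by (subst tensor_pairing_superset[OF _ keys]) (simp_all add: lookup)
  also have "\<dots> = (\<Sum>k\<le>length \<alpha>. functional x (monomial_qsym (take k \<alpha>)) * functional y (monomial_qsym (drop k \<alpha>)))"
    by (subst sum.reindex[OF inj]) simp
  finally show ?thesis .
qed


section \<open>The dual basis\<close>

text \<open>
  \<open>S\<^sub>\<alpha>\<close> is \<open>M\<^sub>\<alpha>\<close> plus terms \<open>M\<^sub>\<beta>\<close> of the same size and with larger \<open>height_stat\<close>. As this statistic is bounded for a
  given size, the values on the monomial basis are found by downward induction.
\<close>

lemma nsym_eqI_qschur:
  assumes eq: "\<And>\<alpha>. composition \<alpha> \<Longrightarrow> functional x (qschur \<alpha>) = functional y (qschur \<alpha>)"
  shows "x = y"
proof (rule nsym_eqI_monomial)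
  fix \<alpha> assume "composition \<alpha>"
  then show "functional x (monomial_qsym \<alpha>) = functional y (monomial_qsym \<alpha>)"
  proof (induction \<alpha> rule: measure_induct_rule[of "\<lambda>\<alpha>. sum_list \<alpha> * sum_list \<alpha> - height_stat \<alpha>"])
    case (less \<alpha>)
    have supp: "\<alpha> \<in> msupp (qschur \<alpha>)"
      using less.prems by (simp add: msupp_def mcoeff_qschur kostka_diag)
    have "functional x (monomial_qsym \<beta>) = functional y (monomial_qsym \<beta>)"
      if "\<beta> \<in> msupp (qschur \<alpha>) - {\<alpha>}" for \<beta>
    proof -
      have \<beta>: "composition \<beta>" "kostka \<alpha> \<beta> \<noteq> 0" "\<alpha> \<noteq> \<beta>"
        using that less.prems by (auto simp: msupp_def mcoeff_qschur)
      then have "sum_list \<alpha> = sum_list \<beta>" "height_stat \<alpha> < height_stat \<beta>"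
        using kostka_nonzero[OF less.prems \<beta>(1,2)] by auto
      moreover have "height_stat \<beta> \<le> sum_list \<beta> * sum_list \<beta>" using height_stat_le[OF \<beta>(1)] .
      ultimately show ?thesis by (intro less.IH \<beta>(1)) simp
    qed
    then have rest: "(\<Sum>\<beta> \<in> msupp (qschur \<alpha>) - {\<alpha>}. mcoeff (qschur \<alpha>) \<beta> * functional x (monomial_qsym \<beta>)) =
        (\<Sum>\<beta> \<in> msupp (qschur \<alpha>) - {\<alpha>}. mcoeff (qschur \<alpha>) \<beta> * functional y (monomial_qsym \<beta>))"
      by (intro sum.cong) auto
    have "functional z (qschur \<alpha>) = functional z (monomial_qsym \<alpha>) +
        (\<Sum>\<beta> \<in> msupp (qschur \<alpha>) - {\<alpha>}. mcoeff (qschur \<alpha>) \<beta> * functional z (monomial_qsym \<beta>))" for z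
      unfolding functional_expansion[of z "qschur \<alpha>"]
      by (subst sum.remove[OF finite_msupp supp])
        (simp add: mcoeff_qschur[OF less.prems] kostka_diag[OF less.prems])
    then show ?case using eq[OF less.prems] rest by simp
  qed
qed

lemma graded_functional_sum:
  "finite A \<Longrightarrow> (\<And>i. i \<in> A \<Longrightarrow> graded_functional (x i)) \<Longrightarrow>
     graded_functional (\<lambda>F. \<Sum>i\<in>A. c i * x i F)"
proof (induction rule: finite_induct)
  case empty
  then show ?case by (simp add: graded_functional_0)
next
  case (insert a A)
  then show ?case
    using graded_functional_lin[of "x a" "\<lambda>F. \<Sum>i\<in>A. c i * x i F" "c a" 1] by simp
qed

lemma ex_coefficient_functional:
  assumes "composition \<alpha>"
  shows "\<exists>x. \<forall>F. functional x F = mcoeff F \<alpha>"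
proof -
  have "functional (of_coordinates (\<lambda>\<beta>. of_bool (\<beta> = \<alpha>))) F = mcoeff F \<alpha>" for F
    using sum_msupp_delta[OF assms]
    by (subst functional_of_coordinates[of "sum_list \<alpha>"]) auto
  then show ?thesis by blast
qed

text \<open>
  Start from the functional that reads off the coefficient of \<open>M\<^sub>\<alpha>\<close>. It is 1 at \<open>S\<^sub>\<alpha>\<close>, and its other nonzero values are
  at \<open>S\<^sub>\<beta>\<close> with smaller \<open>height_stat\<close>, where they are corrected by dual basis elements obtained by
  induction.
\<close>

lemma ex_dual_qschur:
  "composition \<alpha> \<Longrightarrow> \<exists>x. \<forall>\<beta>. composition \<beta> \<longrightarrow> functional x (qschur \<beta>) = of_bool (\<beta> = \<alpha>)"
proof (induction \<alpha> rule: measure_induct_rule[of height_stat])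
  case (less \<alpha>)
  define B where "B = {\<beta>. composition \<beta> \<and> sum_list \<beta> = sum_list \<alpha> \<and> \<beta> \<noteq> \<alpha> \<and> kostka \<beta> \<alpha> \<noteq> 0}"
  have fin: "finite B"
    by (rule finite_subset[OF _ finite_compositions[of "sum_list \<alpha>"]]) (auto simp: B_def)
  have "\<exists>x. \<forall>\<gamma>. composition \<gamma> \<longrightarrow> functional x (qschur \<gamma>) = of_bool (\<gamma> = \<beta>)" if "\<beta> \<in> B" for \<beta>
    using less.IH[of \<beta>] kostka_nonzero[of \<beta> \<alpha>] that less.prems by (auto simp: B_def)
  then obtain y where y: "\<And>\<beta> \<gamma>. \<beta> \<in> B \<Longrightarrow> composition \<gamma> \<Longrightarrow> functional (y \<beta>) (qschur \<gamma>) = of_bool (\<gamma> = \<beta>)"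
    by metis
  obtain z where z: "\<And>F. functional z F = mcoeff F \<alpha>" using ex_coefficient_functional[OF less.prems] by blast
  define x where "x = (\<lambda>F. 1 * functional z F + (-1) * (\<Sum>\<beta>\<in>B. of_nat (kostka \<beta> \<alpha>) * functional (y \<beta>) F))"
  have "graded_functional x"
    unfolding x_def
    by (intro graded_functional_lin graded_functional_sum graded_functional_functional fin)
  then have "functional (Abs_nsym x) = x" by (simp add: Abs_nsym_inverse)
  moreover have "x (qschur \<gamma>) = of_bool (\<gamma> = \<alpha>)" if \<gamma>: "composition \<gamma>" for \<gamma>
  proof -
    have "x (qschur \<gamma>) = of_nat (kostka \<gamma> \<alpha>) - (\<Sum>\<beta>\<in>B. of_nat (kostka \<beta> \<alpha>) * of_bool (\<gamma> = \<beta>))"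
      using y \<gamma> by (simp add: x_def z mcoeff_qschur)
    also have "(\<Sum>\<beta>\<in>B. of_nat (kostka \<beta> \<alpha>) * of_bool (\<gamma> = \<beta>)) = (of_bool (\<gamma> \<in> B) * of_nat (kostka \<gamma> \<alpha>) :: rat)"
      using fin by (simp add: sum.If_cases of_bool_def if_distrib cong: if_cong)
    also have "of_nat (kostka \<gamma> \<alpha>) - of_bool (\<gamma> \<in> B) * of_nat (kostka \<gamma> \<alpha>) = (of_bool (\<gamma> = \<alpha>) :: rat)"
      using kostka_nonzero[OF \<gamma> less.prems] kostka_diag[OF less.prems] \<gamma> by (auto simp: B_def)
    finally show ?thesis .
  qed
  ultimately show ?case by metis
qed

lemma functional_dual_qschur:
  assumes "composition \<alpha>" "composition \<beta>"
  shows "functional (dual_qschur \<alpha>) (qschur \<beta>) = of_bool (\<beta> = \<alpha>)"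
proof -
  have "\<exists>!x. \<forall>\<beta>. composition \<beta> \<longrightarrow> pairing (qschur \<beta>) x = (if \<beta> = \<alpha> then 1 else 0)"
    unfolding pairing_def
  proof (rule ex_ex1I)
    show "\<exists>x. \<forall>\<beta>. composition \<beta> \<longrightarrow> functional x (qschur \<beta>) = (if \<beta> = \<alpha> then 1 else 0)"
      using ex_dual_qschur[OF assms(1)] by (simp add: of_bool_def)
  qed (auto intro: nsym_eqI_qschur)
  from theI'[OF this] show ?thesis
    using assms(2) by (simp add: dual_qschur_def pairing_def)
qed

lemma dual_qschur_eqI:
  assumes "composition \<alpha>" "\<And>\<beta>. composition \<beta> \<Longrightarrow> functional x (qschur \<beta>) = of_bool (\<beta> = \<alpha>)"
  shows "dual_qschur \<alpha> = x"
  by (rule nsym_eqI_qschur) (use assms functional_dual_qschur in simp)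

lemma sum_single_term:
  assumes "finite A" "a \<in> A" "\<And>i. i \<in> A \<Longrightarrow> i \<noteq> a \<Longrightarrow> f i = 0"
  shows "sum f A = f a"
proof -
  have "sum f A = sum f {a}" using assms by (intro sum.mono_neutral_right) auto
  then show ?thesis by simp
qed


section \<open>Multiplication by complete and elementary functionals\<close>

text \<open>
  Evaluates a functional at \<open>S\<^sub>\<gamma>\<close> when its values on the monomial basis obey a recursion on the first part. For each
  \<open>i\<close> the coefficients of the \<open>M\<^bsub>i # \<alpha>\<^esub>\<close> in \<open>S\<^sub>\<gamma>\<close> are, by \<open>kostka_Cons\<close>, the coefficients of the \<open>M\<^sub>\<alpha>\<close> in the sum of the
  \<open>S\<^sub>\<beta>\<close> with \<open>\<beta> \<in> peelings i \<gamma>\<close>.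
\<close>

lemma functional_by_first_part:
  fixes y :: "nat \<Rightarrow> nsym" and c :: "nat \<Rightarrow> rat"
  assumes I: "finite I" "0 \<notin> I"
    and Nil: "functional z (monomial_qsym []) = 0"
    and Cons: "\<And>i \<alpha>. i \<in> I \<Longrightarrow> composition \<alpha> \<Longrightarrow>
      functional z (monomial_qsym (i # \<alpha>)) = c i * functional (y i) (monomial_qsym \<alpha>)"
    and other: "\<And>i \<alpha>. i \<notin> I \<Longrightarrow> composition (i # \<alpha>) \<Longrightarrow> functional z (monomial_qsym (i # \<alpha>)) = 0"
    and \<gamma>: "composition \<gamma>"
  shows "functional z (qschur \<gamma>) = (\<Sum>i\<in>I. c i * (\<Sum>\<beta>\<in>peelings i \<gamma>. functional (y i) (qschur \<beta>)))"
proof -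
  \<comment> \<open>the part of \<open>S\<^sub>\<gamma>\<close> with first part \<open>i\<close>, after removal of that part\<close>
  define G where "G i = (\<Sum>\<beta>\<in>peelings i \<gamma>. qschur \<beta>)" for i
  have G: "mcoeff (G i) \<alpha> = mcoeff (qschur \<gamma>) (i # \<alpha>)" for i \<alpha>
  proof -
    have "mcoeff (G i) \<alpha> = (\<Sum>\<beta>\<in>peelings i \<gamma>. of_nat (kostka \<beta> \<alpha>))"
      unfolding G_def mcoeff_sum by (intro sum.cong) (auto simp: peelings_def mcoeff_qschur)
    then show ?thesis by (simp add: mcoeff_qschur[OF \<gamma>] kostka_Cons[OF \<gamma>])
  qed
  let ?S = "Sigma I (\<lambda>i. msupp (G i))"
  let ?f = "\<lambda>\<alpha>. mcoeff (qschur \<gamma>) \<alpha> * functional z (monomial_qsym \<alpha>)"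
  have inj: "inj_on (\<lambda>(i, \<alpha>). i # \<alpha>) ?S" by (auto simp: inj_on_def)
  have img: "(\<lambda>(i, \<alpha>). i # \<alpha>) ` ?S \<subseteq> msupp (qschur \<gamma>)"
    using I(2) by (auto simp: msupp_def G composition_def)
  have zero: "?f \<alpha> = 0" if "\<alpha> \<in> msupp (qschur \<gamma>) - (\<lambda>(i, \<alpha>). i # \<alpha>) ` ?S" for \<alpha>
  proof (cases \<alpha>)
    case (Cons i \<beta>)
    have "i \<notin> I"
    proof
      assume "i \<in> I"
      moreover have "\<beta> \<in> msupp (G i)"
        using that unfolding Cons by (simp add: msupp_def G composition_def)
      ultimately have "\<alpha> \<in> (\<lambda>(i, \<alpha>). i # \<alpha>) ` ?S"
        unfolding Cons by (intro image_eqI[of _ _ "(i, \<beta>)"]) auto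
      then show False using that by blast
    qed
    then show ?thesis using that Cons other by (simp add: msupp_def)
  qed (simp add: Nil)
  have "functional z (qschur \<gamma>) = sum ?f (msupp (qschur \<gamma>))"
    by (rule functional_expansion)
  also have "\<dots> = sum ?f ((\<lambda>(i, \<alpha>). i # \<alpha>) ` ?S)"
    using img zero by (intro sum.mono_neutral_right finite_msupp) auto
  also have "\<dots> = (\<Sum>(i, \<alpha>)\<in>?S. ?f (i # \<alpha>))"
    by (subst sum.reindex[OF inj]) (simp add: case_prod_unfold)
  also have "\<dots> = (\<Sum>i\<in>I. \<Sum>\<alpha>\<in>msupp (G i). ?f (i # \<alpha>))"
    using I(1) by (subst sum.Sigma) (auto simp: finite_msupp)
  also have "\<dots> = (\<Sum>i\<in>I. c i * functional (y i) (G i))"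
  proof (intro sum.cong HOL.refl)
    fix i assume i: "i \<in> I"
    have "(\<Sum>\<alpha>\<in>msupp (G i). ?f (i # \<alpha>)) =
        (\<Sum>\<alpha>\<in>msupp (G i). c i * (mcoeff (G i) \<alpha> * functional (y i) (monomial_qsym \<alpha>)))"
    proof (rule sum.cong[OF HOL.refl])
      fix \<alpha> assume "\<alpha> \<in> msupp (G i)"
      then have "composition \<alpha>" by (simp add: msupp_def)
      then show "?f (i # \<alpha>) = c i * (mcoeff (G i) \<alpha> * functional (y i) (monomial_qsym \<alpha>))"
        using Cons[OF i] by (simp add: G)
    qed
    then show "(\<Sum>\<alpha>\<in>msupp (G i). ?f (i # \<alpha>)) = c i * functional (y i) (G i)"
      by (simp add: functional_expansion[of "y i" "G i"] sum_distrib_left)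
  qed
  finally show ?thesis by (simp add: G_def)
qed

text \<open>
  The complete homogeneous noncommutative symmetric functions, which are dual to the monomial basis at
  the one-part compositions.
\<close>

definition complete :: "nat \<Rightarrow> nsym" where
  "complete n = of_coordinates (\<lambda>\<alpha>. of_bool (\<alpha> = [n]))"

lemma functional_complete_monomial:
  "composition \<alpha> \<Longrightarrow> functional (complete n) (monomial_qsym \<alpha>) = of_bool (\<alpha> = [n])"
  unfolding complete_def by (rule functional_of_coordinates_monomial[of n]) auto

lemma functional_complete:
  assumes "n > 0"
  shows "functional (complete n) F = mcoeff F [n]"
  unfolding complete_def
  using sum_msupp_delta[of "[n]" F] assms
  by (subst functional_of_coordinates[of n]) (auto simp: composition_def)

text \<open>
  Weight \<open>[n]\<close> means that all entries are 1; as the first column strictly increases, the shape has one row.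
\<close>

lemma complete_eq_dual_qschur:
  assumes "n > 0"
  shows "dual_qschur [n] = complete n"
proof (rule dual_qschur_eqI)
  show n: "composition [n]" using assms by (simp add: composition_def)
  fix \<beta> assume \<beta>: "composition \<beta>"
  have "kostka \<beta> [n] = of_bool (\<beta> = [n])"
  proof (cases "kostka \<beta> [n] = 0")
    case False
    then have "sum_list \<beta> = n" "length \<beta> \<le> 1" using kostka_nonzero[OF \<beta> n] by auto
    then have "\<beta> = [n]" using assms by (cases \<beta>) auto
    then show ?thesis using kostka_diag[OF n] by simp
  qed (use kostka_diag[OF n] in auto)
  then show "functional (complete n) (qschur \<beta>) = of_bool (\<beta> = [n])"
    by (simp add: functional_complete[OF assms] mcoeff_qschur[OF \<beta>])
qed

text \<open>
  Only the cut after the first part contributes to the product, and it requires this part to be \<open>n\<close>.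
\<close>

lemma functional_complete_times_qschur:
  assumes n: "n > 0" and \<gamma>: "composition \<gamma>"
  shows "functional (complete n * z) (qschur \<gamma>) = (\<Sum>\<beta>\<in>peelings n \<gamma>. functional z (qschur \<beta>))"
proof -
  have Cons: "functional (complete n * z) (monomial_qsym (i # \<alpha>)) =
      of_bool (i = n) * functional z (monomial_qsym \<alpha>)" if "composition (i # \<alpha>)" for i \<alpha>
  proof -
    have "functional (complete n * z) (monomial_qsym (i # \<alpha>)) =
        (\<Sum>k\<le>length (i # \<alpha>). of_bool (take k (i # \<alpha>) = [n]) * functional z (monomial_qsym (drop k (i # \<alpha>))))"
      by (simp only: functional_times_monomial[OF that] functional_complete_monomial composition_take[OF that])
    also have "\<dots> = of_bool (take 1 (i # \<alpha>) = [n]) * functional z (monomial_qsym (drop 1 (i # \<alpha>)))"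
    proof (rule sum_single_term)
      fix k assume k: "k \<in> {..length (i # \<alpha>)}" "k \<noteq> 1"
      have "take k (i # \<alpha>) \<noteq> [n]"
      proof
        assume "take k (i # \<alpha>) = [n]"
        then have "length (take k (i # \<alpha>)) = 1" by simp
        then show False using k by simp
      qed
      then show "of_bool (take k (i # \<alpha>) = [n]) * functional z (monomial_qsym (drop k (i # \<alpha>))) = 0" by simp
    qed auto
    finally show ?thesis by simp
  qed
  have "functional (complete n * z) (qschur \<gamma>) =
      (\<Sum>i\<in>{n}. 1 * (\<Sum>\<beta>\<in>peelings i \<gamma>. functional z (qschur \<beta>)))"
  proof (rule functional_by_first_part)
    show "functional (complete n * z) (monomial_qsym []) = 0"
      by (simp add: functional_times_monomial functional_complete_monomial)
  qed (use n \<gamma> Cons in \<open>auto simp: composition_Cons\<close>)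
  then show ?thesis by simp
qed

text \<open>
  The elementary noncommutative symmetric functions. The exponent \<open>n + length \<alpha>\<close> has the parity of
  \<open>n - length \<alpha>\<close>.
\<close>

definition elementary :: "nat \<Rightarrow> nsym" where
  "elementary n = of_coordinates (\<lambda>\<alpha>. of_bool (sum_list \<alpha> = n) * (-1) ^ (n + length \<alpha>))"

lemma functional_elementary_monomial:
  "composition \<alpha> \<Longrightarrow>
     functional (elementary n) (monomial_qsym \<alpha>) = of_bool (sum_list \<alpha> = n) * (-1) ^ (n + length \<alpha>)"
  unfolding elementary_def by (rule functional_of_coordinates_monomial[of n]) auto

lemma elementary_0_times: "elementary 0 * z = z"
proof (rule nsym_eqI_monomial)
  fix \<alpha> assume \<alpha>: "composition \<alpha>"
  have "functional (elementary 0 * z) (monomial_qsym \<alpha>) =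
      functional (elementary 0) (monomial_qsym (take 0 \<alpha>)) * functional z (monomial_qsym (drop 0 \<alpha>))"
    unfolding functional_times_monomial[OF \<alpha>]
  proof (rule sum_single_term)
    fix k assume k: "k \<in> {..length \<alpha>}" "k \<noteq> 0"
    have "length (take k \<alpha>) \<le> sum_list (take k \<alpha>)" using length_le_sum_list composition_take[OF \<alpha>] by blast
    moreover have "length (take k \<alpha>) = k" "0 < k" using k by auto
    ultimately have "sum_list (take k \<alpha>) \<noteq> 0" by linarith
    then show "functional (elementary 0) (monomial_qsym (take k \<alpha>)) * functional z (monomial_qsym (drop k \<alpha>)) = 0"
      using composition_take[OF \<alpha>] by (simp add: functional_elementary_monomial)
  qed auto
  then show "functional (elementary 0 * z) (monomial_qsym \<alpha>) = functional z (monomial_qsym \<alpha>)"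
    by (simp add: functional_elementary_monomial)
qed

text \<open>
  The product of \<open>elementary n\<close> with \<open>z\<close> is the alternating sum over \<open>i\<close> of \<open>complete i\<close> times the product of
  \<open>elementary (n - i)\<close> with \<open>z\<close>: prefixing the part \<open>i\<close> changes size and length in such a way that
  the sign changes by \<open>(-1)\<^bsup>i - 1\<^esup>\<close>.
\<close>

lemma functional_elementary_times_qschur:
  assumes n: "n > 0" and \<gamma>: "composition \<gamma>"
  shows "functional (elementary n * z) (qschur \<gamma>) =
    (\<Sum>i\<in>{1..n}. (-1) ^ (i + 1) * (\<Sum>\<beta>\<in>peelings i \<gamma>. functional (elementary (n - i) * z) (qschur \<beta>)))"
proof (rule functional_by_first_part)
  show "functional (elementary n * z) (monomial_qsym []) = 0"
    using n by (simp add: functional_times_monomial functional_elementary_monomial)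
  have Cons: "functional (elementary n * z) (monomial_qsym (i # \<alpha>)) =
      (if i \<le> n then (-1) ^ (i + 1) * functional (elementary (n - i) * z) (monomial_qsym \<alpha>) else 0)"
    if comp: "composition (i # \<alpha>)" for i \<alpha>
  proof -
    have \<alpha>: "composition \<alpha>" and i: "0 < i" using comp by (auto simp: composition_Cons)
    have e: "functional (elementary n) (monomial_qsym (i # take k \<alpha>)) =
        (if i \<le> n then (-1) ^ (i + 1) * functional (elementary (n - i)) (monomial_qsym (take k \<alpha>)) else 0)" for k
    proof -
      have "(-1 :: rat) ^ (n + length (i # take k \<alpha>)) = (-1) ^ (i + 1) * (-1) ^ (n - i + length (take k \<alpha>))"
        if "i \<le> n"
      proof -
        have "n + length (i # take k \<alpha>) = (i + 1) + (n - i + length (take k \<alpha>))" using that by simp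
        then show ?thesis by (simp only: power_add)
      qed
      then show ?thesis
        using composition_take[OF \<alpha>, of k] composition_take[OF comp, of "Suc k"] i
        by (auto simp: functional_elementary_monomial)
    qed
    have "functional (elementary n * z) (monomial_qsym (i # \<alpha>)) =
       (\<Sum>k\<le>length \<alpha>. functional (elementary n) (monomial_qsym (i # take k \<alpha>)) * functional z (monomial_qsym (drop k \<alpha>)))"
      unfolding functional_times_monomial[OF comp]
      using n by (simp add: sum.atMost_Suc_shift functional_elementary_monomial del: sum.atMost_Suc)
    then show ?thesis
      unfolding e functional_times_monomial[OF \<alpha>] by (simp add: sum_distrib_left mult.assoc)
  qed
  then show "functional (elementary n * z) (monomial_qsym (i # \<alpha>)) =
      (-1) ^ (i + 1) * functional (elementary (n - i) * z) (monomial_qsym \<alpha>)"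
    if "i \<in> {1..n}" "composition \<alpha>" for i \<alpha>
    using that by (simp add: composition_Cons)
  show "functional (elementary n * z) (monomial_qsym (i # \<alpha>)) = 0"
    if "i \<notin> {1..n}" "composition (i # \<alpha>)" for i \<alpha>
    using that Cons[OF that(2)] by (auto simp: composition_Cons)
qed (use \<gamma> in auto)


section \<open>Weakly decreasing chains followed by strips\<close>

text \<open>
  Let the word start with \<open>x, y\<close>. If \<open>x < y\<close> then the weakly decreasing prefix has at most one letter, and both
  lengths 0 and 1 are possible exactly if the whole word increases. Otherwise \<open>x\<close> always
  belongs to the prefix and can be dropped.
\<close>

lemma alternating_sum_of_splits:
  fixes w :: "nat list"
  assumes "w \<noteq> []"
  shows "(\<Sum>j\<le>length w. (-1) ^ j * of_bool (sorted_wrt (\<ge>) (take j w) \<and> sorted_wrt (<) (drop j w))) = (0 :: rat)"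
  using assms
proof (induction w)
  case (Cons x v)
  let ?s = "\<lambda>w j. (-1) ^ j * of_bool (sorted_wrt (\<ge>) (take j w) \<and> sorted_wrt (<) (drop j w)) :: rat"
  have shift: "(\<Sum>j\<le>length (x # v). ?s (x # v) j) =
      of_bool (sorted_wrt (<) (x # v)) + (\<Sum>j\<le>length v. ?s (x # v) (Suc j))"
    by (simp add: sum.atMost_Suc_shift del: sum.atMost_Suc sorted_wrt.simps(2))
  show ?case
  proof (cases v)
    case Nil
    then show ?thesis by simp
  next
    case v: (Cons y u)
    show ?thesis
    proof (cases "x < y")
      case True
      have "?s (x # v) (Suc j) = 0" if "j \<noteq> 0" for j
        using that True v by (cases j) auto
      then have "(\<Sum>j\<le>length v. ?s (x # v) (Suc j)) = ?s (x # v) (Suc 0)"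
        by (intro sum_single_term) auto
      moreover have "sorted_wrt (<) (x # v) \<longleftrightarrow> sorted_wrt (<) v"
        using True v by (auto simp: sorted_wrt2)
      ultimately show ?thesis unfolding shift by simp
    next
      case False
      have "?s (x # v) (Suc j) = - ?s v j" for j
        using False v by (cases j) (auto simp: sorted_wrt2)
      then have "(\<Sum>j\<le>length v. ?s (x # v) (Suc j)) = - (\<Sum>j\<le>length v. ?s v j)"
        by (simp only: sum_negf)
      also have "\<dots> = 0" using Cons.IH v by simp
      finally show ?thesis unfolding shift using False v by simp
    qed
  qed
qed simp

text \<open>
  The vertical strips of size \<open>n\<close> whose cells have been added from right to left: along such a chain no row
  grows twice.
\<close>

definition weakly_decreasing_chain :: "nat \<Rightarrow> nat list \<Rightarrow> nat list \<Rightarrow> bool" where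
  "weakly_decreasing_chain n \<beta> \<gamma> \<longleftrightarrow> (\<exists>cs. saturated_chain \<beta> cs \<gamma> \<and> sorted_wrt (\<ge>) cs \<and> length cs = n)"

lemma peelings_iff:
  assumes "composition \<beta>" "composition \<gamma>"
  shows "\<beta> \<in> peelings n \<gamma> \<longleftrightarrow> (\<exists>cs. saturated_chain \<beta> cs \<gamma> \<and> sorted_wrt (<) cs \<and> length cs = n)"
  using left_right_strip_if_chain[OF _ assms(1), of _ \<gamma>] chain_if_left_right_strip[OF _ assms]
    saturated_chain_columns(2)[OF _ assms(1), of _ \<gamma>] assms
  unfolding peelings_def by (auto 4 4)

lemma finite_chain_words:
  assumes "composition \<beta>"
  shows "finite {w. length w = n \<and> saturated_chain \<beta> w \<gamma>}"
proof (rule finite_subset)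
  show "{w. length w = n \<and> saturated_chain \<beta> w \<gamma>} \<subseteq> {w. set w \<subseteq> snd ` new_cells \<beta> \<gamma> \<and> length w = n}"
    using saturated_chain_columns(1)[OF _ assms, of _ \<gamma>] by auto
  show "finite {w. set w \<subseteq> snd ` new_cells \<beta> \<gamma> \<and> length w = n}"
    by (rule finite_lists_length_eq) simp
qed

text \<open>
  An intermediate composition \<open>\<delta>\<close> corresponds to a word of columns from \<open>\<beta>\<close> to \<open>\<gamma>\<close> with a cut: given the word, \<open>\<delta>\<close> is reached
  after its first \<open>n - i\<close> letters, and given \<open>\<delta>\<close>, both parts of the word are determined because
  they are sorted.
\<close>

lemma card_decreasing_chain_then_strip:
  assumes \<beta>: "composition \<beta>" and \<gamma>: "composition \<gamma>" and "i \<le> n"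
  shows "card {\<delta> \<in> peelings i \<gamma>. weakly_decreasing_chain (n - i) \<beta> \<delta>} =
    card {w. (length w = n \<and> saturated_chain \<beta> w \<gamma>) \<and>
       sorted_wrt (\<ge>) (take (n - i) w) \<and> sorted_wrt (<) (drop (n - i) w)}" (is "card ?D = card ?W")
proof (rule bij_betw_same_card[symmetric])
  \<comment> \<open>the composition reached at the cut\<close>
  define mid where "mid w = (THE \<delta>. saturated_chain \<beta> (take (n - i) w) \<delta>)" for w
  have mid_eq: "mid w = \<delta>" if "saturated_chain \<beta> (take (n - i) w) \<delta>" for w \<delta>
    unfolding mid_def using that saturated_chain_deterministic[OF _ that \<beta>] by (rule the_equality)
  have mid: "saturated_chain \<beta> (take (n - i) w) (mid w)" "saturated_chain (mid w) (drop (n - i) w) \<gamma>"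
    if "w \<in> ?W" for w
  proof -
    have "saturated_chain \<beta> (take (n - i) w @ drop (n - i) w) \<gamma>" using that by simp
    then obtain \<delta> where "saturated_chain \<beta> (take (n - i) w) \<delta>" "saturated_chain \<delta> (drop (n - i) w) \<gamma>"
      unfolding saturated_chain_append_iff by blast
    then show "saturated_chain \<beta> (take (n - i) w) (mid w)" "saturated_chain (mid w) (drop (n - i) w) \<gamma>"
      using mid_eq by simp_all
  qed
  show "bij_betw mid ?W ?D"
    unfolding bij_betw_def
  proof (intro conjI inj_onI equalityI subsetI)
    fix w w' assume w: "w \<in> ?W" "w' \<in> ?W" "mid w = mid w'"
    have \<delta>: "composition (mid w)" using saturated_chain_composition[OF mid(1)[OF w(1)] \<beta>] .
    have "take (n - i) w = take (n - i) w'"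
      by (rule sorted_columns_unique(2)[OF mid(1)[OF w(1)] _ \<beta>]) (use mid(1)[OF w(2)] w in auto)
    moreover have "drop (n - i) w = drop (n - i) w'"
      by (rule sorted_columns_unique(1)[OF mid(2)[OF w(1)] _ \<delta>]) (use mid(2)[OF w(2)] w in auto)
    ultimately show "w = w'" by (metis append_take_drop_id)
  next
    fix \<delta> assume "\<delta> \<in> mid ` ?W"
    then obtain w where w: "w \<in> ?W" "\<delta> = mid w" by blast
    have \<delta>: "composition \<delta>" using saturated_chain_composition[OF mid(1)[OF w(1)] \<beta>] w(2) by simp
    have "length (take (n - i) w) = n - i" "length (drop (n - i) w) = i"
      using w(1) \<open>i \<le> n\<close> by auto
    then show "\<delta> \<in> ?D"
      unfolding mem_Collect_eq peelings_iff[OF \<delta> \<gamma>] weakly_decreasing_chain_def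
      using mid[OF w(1), folded w(2)] w(1) by blast
  next
    fix \<delta> assume d: "\<delta> \<in> ?D"
    then have \<delta>: "composition \<delta>" by (simp add: peelings_def)
    obtain cs where cs: "saturated_chain \<beta> cs \<delta>" "sorted_wrt (\<ge>) cs" "length cs = n - i"
      using d by (auto simp: weakly_decreasing_chain_def)
    obtain ds where ds: "saturated_chain \<delta> ds \<gamma>" "sorted_wrt (<) ds" "length ds = i"
      using d peelings_iff[OF \<delta> \<gamma>] by auto
    have "saturated_chain \<beta> (cs @ ds) \<gamma>" unfolding saturated_chain_append_iff using cs ds by blast
    then have "cs @ ds \<in> ?W" using cs ds \<open>i \<le> n\<close> by simp
    moreover have "mid (cs @ ds) = \<delta>" using cs by (intro mid_eq) simp
    ultimately show "\<delta> \<in> mid ` ?W" by blast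
  qed
qed

lemma peelings_0: "composition \<gamma> \<Longrightarrow> peelings 0 \<gamma> = {\<gamma>}"
proof -
  assume \<gamma>: "composition \<gamma>"
  have "\<beta> = \<gamma>" if "\<beta> \<in> peelings 0 \<gamma>" for \<beta>
  proof -
    have "new_cells \<beta> \<gamma> = {}" "height_cells \<beta> \<subseteq> height_cells \<gamma>" "composition \<beta>"
      using that by (auto simp: peelings_def left_right_strip_def)
    then show ?thesis using \<gamma> by (intro composition_eqI) (auto simp: new_cells_def)
  qed
  moreover have "\<gamma> \<in> peelings 0 \<gamma>"
    using \<gamma> by (simp add: peelings_def left_right_strip_def new_cells_def)
  ultimately show ?thesis by blast
qed

lemma alternating_sum_decreasing_chains_strips:
  assumes \<beta>: "composition \<beta>" and \<gamma>: "composition \<gamma>" and n: "n > 0"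
  shows "(\<Sum>i\<le>n. (-1) ^ i * (\<Sum>\<delta>\<in>peelings i \<gamma>. of_bool (weakly_decreasing_chain (n - i) \<beta> \<delta>))) = (0 :: rat)"
proof -
  define W where "W = {w. length w = n \<and> saturated_chain \<beta> w \<gamma>}"
  have W: "finite W" unfolding W_def using finite_chain_words[OF \<beta>] .
  let ?v = "\<lambda>j w. of_bool (sorted_wrt (\<ge>) (take j w) \<and> sorted_wrt (<) (drop j w)) :: rat"
  have inner: "(\<Sum>\<delta>\<in>peelings i \<gamma>. of_bool (weakly_decreasing_chain (n - i) \<beta> \<delta>)) = (\<Sum>w\<in>W. ?v (n - i) w)" if "i \<le> n" for i
  proof -
    have "(\<Sum>\<delta>\<in>peelings i \<gamma>. of_bool (weakly_decreasing_chain (n - i) \<beta> \<delta>)) =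
        (of_nat (card {\<delta> \<in> peelings i \<gamma>. weakly_decreasing_chain (n - i) \<beta> \<delta>}) :: rat)"
      by (simp add: Int_def)
    also have "\<dots> = of_nat (card {w \<in> W. sorted_wrt (\<ge>) (take (n - i) w) \<and> sorted_wrt (<) (drop (n - i) w)})"
      unfolding card_decreasing_chain_then_strip[OF \<beta> \<gamma> that] by (simp add: W_def)
    also have "\<dots> = (\<Sum>w\<in>W. ?v (n - i) w)"
      using W by (simp add: Int_def)
    finally show ?thesis .
  qed
  have "(\<Sum>i\<le>n. (-1) ^ i * (\<Sum>\<delta>\<in>peelings i \<gamma>. of_bool (weakly_decreasing_chain (n - i) \<beta> \<delta>))) =
      (\<Sum>i\<le>n. \<Sum>w\<in>W. (-1) ^ i * ?v (n - i) w)"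
  proof (rule sum.cong[OF HOL.refl])
    fix i assume "i \<in> {..n}"
    then have "i \<le> n" by simp
    from inner[OF this]
    show "(-1) ^ i * (\<Sum>\<delta>\<in>peelings i \<gamma>. of_bool (weakly_decreasing_chain (n - i) \<beta> \<delta>)) = (\<Sum>w\<in>W. (-1) ^ i * ?v (n - i) w)"
      by (simp only: sum_distrib_left)
  qed
  also have "\<dots> = (\<Sum>w\<in>W. \<Sum>i\<le>n. (-1) ^ i * ?v (n - i) w)"
    by (rule sum.swap)
  also have "\<dots> = (\<Sum>w\<in>W. 0)"
  proof (rule sum.cong[OF HOL.refl])
    fix w assume "w \<in> W"
    then have len: "length w = n" by (simp add: W_def)
    have "(\<Sum>i\<le>n. (-1) ^ i * ?v (n - i) w) = (\<Sum>j\<le>n. (-1) ^ (n - j) * ?v j w)"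
      by (rule sum.reindex_bij_witness[of _ "\<lambda>j. n - j" "\<lambda>j. n - j"]) auto
    also have "\<dots> = (\<Sum>j\<le>n. (-1) ^ n * ((-1) ^ j * ?v j w))"
    proof (intro sum.cong HOL.refl)
      fix j assume "j \<in> {..n}"
      then have "n + j = (n - j) + 2 * j" by simp
      then have "(-1 :: rat) ^ (n + j) = (-1) ^ (n - j) * (-1) ^ (2 * j)" by (simp only: power_add)
      then have "(-1 :: rat) ^ n * (-1) ^ j = (-1) ^ (n - j)" by (simp add: power_add)
      then show "(-1) ^ (n - j) * ?v j w = (-1) ^ n * ((-1) ^ j * ?v j w)"
        by (simp flip: mult.assoc)
    qed
    also have "\<dots> = (-1) ^ n * (\<Sum>j\<le>length w. (-1) ^ j * ?v j w)"
      by (simp only: len sum_distrib_left)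
    also have "\<dots> = 0" using alternating_sum_of_splits[of w] len n by fastforce
    finally show "(\<Sum>i\<le>n. (-1) ^ i * ?v (n - i) w) = 0" .
  qed
  finally show ?thesis by simp
qed

text \<open>
  In the alternating recursion for \<open>elementary n\<close> the term \<open>i = 0\<close> is missing; by the cancellation of split words
  it is what the other terms add up to.
\<close>

lemma functional_elementary_times_dual_qschur:
  assumes \<beta>: "composition \<beta>"
  shows "composition \<gamma> \<Longrightarrow>
    functional (elementary n * dual_qschur \<beta>) (qschur \<gamma>) = of_bool (weakly_decreasing_chain n \<beta> \<gamma>)"
proof (induction n arbitrary: \<gamma> rule: less_induct)
  case (less n)
  show ?case
  proof (cases "n = 0")
    case True
    have "weakly_decreasing_chain 0 \<beta> \<gamma> \<longleftrightarrow> \<gamma> = \<beta>"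
      unfolding weakly_decreasing_chain_def by (auto elim: saturated_chain.cases intro: saturated_chain.refl)
    then show ?thesis
      using True functional_dual_qschur[OF \<beta> less.prems] by (simp add: elementary_0_times)
  next
    case False
    then have n: "n > 0" by simp
    let ?t = "\<lambda>i. \<Sum>\<delta>\<in>peelings i \<gamma>. of_bool (weakly_decreasing_chain (n - i) \<beta> \<delta>) :: rat"
    have "functional (elementary n * dual_qschur \<beta>) (qschur \<gamma>) = (\<Sum>i\<in>{1..n}. (-1) ^ (i + 1) * ?t i)"
      unfolding functional_elementary_times_qschur[OF n less.prems]
    proof (intro sum.cong HOL.refl arg_cong2[where f = "(*)"])
      fix i \<delta> assume "i \<in> {1..n}" "\<delta> \<in> peelings i \<gamma>"
      then show "functional (elementary (n - i) * dual_qschur \<beta>) (qschur \<delta>) = of_bool (weakly_decreasing_chain (n - i) \<beta> \<delta>)"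
        by (intro less.IH) (auto simp: peelings_def)
    qed
    also have "\<dots> = - (\<Sum>i\<in>{1..n}. (-1) ^ i * ?t i)"
      by (simp flip: sum_negf)
    also have "\<dots> = ?t 0 - (\<Sum>i\<in>{0..n}. (-1) ^ i * ?t i)"
      by (subst sum.atLeast_Suc_atMost) auto
    also have "\<dots> = of_bool (weakly_decreasing_chain n \<beta> \<gamma>)"
      using alternating_sum_decreasing_chains_strips[OF \<beta> less.prems n] peelings_0[OF less.prems]
      by (simp add: atLeast0AtMost)
    finally show ?thesis .
  qed
qed


section \<open>The product formulas\<close>

lemma functional_dual_qschur_Nil:
  assumes "composition \<alpha>"
  shows "functional (dual_qschur []) (monomial_qsym \<alpha>) = of_bool (\<alpha> = [])"
proof -
  have "functional (of_coordinates (\<lambda>\<alpha>. of_bool (\<alpha> = []))) F = mcoeff F []" for F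
    using sum_msupp_delta[of "[]" F] by (subst functional_of_coordinates[of 0]) auto
  then have "dual_qschur [] = of_coordinates (\<lambda>\<alpha>. of_bool (\<alpha> = []))"
    by (intro dual_qschur_eqI) (auto simp: mcoeff_qschur kostka_Nil)
  then show ?thesis
    by (simp only:, intro functional_of_coordinates_monomial[of 0]) (use assms in auto)
qed

text \<open>
  \<open>S\<^sup>*\<^bsub>()\<^esub>\<close> is the counit of \<open>QSym\<close>, hence a unit of \<open>NSym\<close>.
\<close>

lemma times_dual_qschur_Nil: "x * dual_qschur [] = x"
proof (rule nsym_eqI_monomial)
  fix \<alpha> assume \<alpha>: "composition \<alpha>"
  have "functional (x * dual_qschur []) (monomial_qsym \<alpha>) =
      functional x (monomial_qsym (take (length \<alpha>) \<alpha>)) *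
      functional (dual_qschur []) (monomial_qsym (drop (length \<alpha>) \<alpha>))"
    unfolding functional_times_monomial[OF \<alpha>]
    by (rule sum_single_term) (auto simp: functional_dual_qschur_Nil composition_drop[OF \<alpha>])
  then show "functional (x * dual_qschur []) (monomial_qsym \<alpha>) = functional x (monomial_qsym \<alpha>)"
    by (simp add: functional_dual_qschur_Nil)
qed

lemma covers_at_replicate_1:
  assumes "covers_at (replicate n 1) 1 \<gamma>"
  shows "\<gamma> = replicate (Suc n) 1"
  using assms
proof cases
  case (grow k \<beta>1 \<beta>2)
  then have "0 \<in> set (replicate n (1 :: nat))" by auto
  then show ?thesis by simp
qed simp

lemma saturated_chain_replicate_1: "saturated_chain [] (replicate n 1) (replicate n 1)"
proof (induction n)
  case 0
  then show ?case by (simp add: saturated_chain.refl)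
next
  case (Suc n)
  have "saturated_chain [] (replicate n 1 @ [1]) (1 # replicate n 1)"
    using saturated_chain.step[OF Suc covers_at.prepend] .
  then show ?case by (simp add: replicate_append_same)
qed

text \<open>
  The empty composition can only grow in column 1, and no later column may be larger.
\<close>

lemma weakly_decreasing_chain_from_Nil:
  "saturated_chain \<beta> cs \<gamma> \<Longrightarrow> \<beta> = [] \<Longrightarrow> sorted_wrt (\<ge>) cs \<Longrightarrow>
     cs = replicate (length cs) 1 \<and> \<gamma> = replicate (length cs) 1"
proof (induction rule: saturated_chain.induct)
  case (refl \<beta>)
  then show ?case by simp
next
  case (step \<beta> cs \<gamma> c \<delta>)
  then have IH: "cs = replicate (length cs) 1" "\<gamma> = replicate (length cs) 1"
    by (simp_all add: sorted_wrt_append)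
  have "1 \<le> c" using step.hyps(2) by cases auto
  moreover have "c \<le> 1"
  proof (cases "cs = []")
    case True
    then have "\<gamma> = []" using IH by simp
    with step.hyps(2) show ?thesis by cases auto
  next
    case False
    then have "1 \<in> set cs" by (subst IH(1)) simp
    then show ?thesis using step.prems(2) by (simp add: sorted_wrt_append)
  qed
  ultimately have c: "c = 1" by simp
  have "covers_at (replicate (length cs) 1) 1 \<delta>" using step.hyps(2) IH(2) c by simp
  then have "\<delta> = replicate (Suc (length cs)) 1" by (rule covers_at_replicate_1)
  moreover have "cs @ [c] = replicate (Suc (length cs)) 1"
    by (subst IH(1)) (simp add: c replicate_append_same)
  ultimately show ?case by simp
qed

text \<open>
  Apply the product formula for \<open>elementary n\<close> to the unit.
\<close>

lemma elementary_eq_dual_qschur: "dual_qschur (replicate n 1) = elementary n"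
proof (rule dual_qschur_eqI)
  show "composition (replicate n 1)" by (simp add: composition_def)
  fix \<gamma> assume \<gamma>: "composition \<gamma>"
  have "sorted_wrt (\<ge>) (replicate n (1 :: nat))" by (induction n) auto
  then have "weakly_decreasing_chain n [] (replicate n 1)"
    unfolding weakly_decreasing_chain_def using saturated_chain_replicate_1 by (intro exI[of _ "replicate n 1"]) simp
  then have "weakly_decreasing_chain n [] \<gamma> \<longleftrightarrow> \<gamma> = replicate n 1"
    using weakly_decreasing_chain_from_Nil[OF _ HOL.refl] unfolding weakly_decreasing_chain_def by blast
  then show "functional (elementary n) (qschur \<gamma>) = of_bool (\<gamma> = replicate n 1)"
    using functional_elementary_times_dual_qschur[of "[]" \<gamma> n] \<gamma> by (simp add: times_dual_qschur_Nil)
qed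

lemma functional_sum_left: "functional (\<Sum>i\<in>A. x i) F = (\<Sum>i\<in>A. functional (x i) F)"
  by (induction A rule: infinite_finite_induct) (simp_all add: zero_nsym.rep_eq plus_nsym.rep_eq)

lemma eq_sum_dual_qschur:
  assumes "finite S" "\<And>\<gamma>. \<gamma> \<in> S \<Longrightarrow> composition \<gamma>"
    and "\<And>\<gamma>. composition \<gamma> \<Longrightarrow> functional x (qschur \<gamma>) = of_bool (\<gamma> \<in> S)"
  shows "x = (\<Sum>\<gamma>\<in>S. dual_qschur \<gamma>)"
proof (rule nsym_eqI_qschur)
  fix \<alpha> assume \<alpha>: "composition \<alpha>"
  have "functional (\<Sum>\<gamma>\<in>S. dual_qschur \<gamma>) (qschur \<alpha>) = (\<Sum>\<gamma>\<in>S. if \<gamma> = \<alpha> then 1 else 0)"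
    unfolding functional_sum_left using functional_dual_qschur assms(2) \<alpha>
    by (intro sum.cong) auto
  also have "\<dots> = of_bool (\<alpha> \<in> S)" using assms(1) by simp
  finally show "functional x (qschur \<alpha>) = functional (\<Sum>\<gamma>\<in>S. dual_qschur \<gamma>) (qschur \<alpha>)"
    using assms(3)[OF \<alpha>] by simp
qed

text \<open>
  A chain with strictly increasing columns makes the other conditions on \<open>\<gamma>\<close> automatic, except for the number of cells.
\<close>

lemma horizontal_strips_eq:
  assumes \<beta>: "composition \<beta>"
  shows "{\<gamma>. composition \<gamma> \<and> \<beta> \<le>\<^sub>C \<gamma> \<and> skew_size \<gamma> \<beta> = n \<and>
      horizontal_strip (skew_cells \<gamma> \<beta>) \<and> added_left_to_right \<beta> \<gamma>} =
    {\<gamma>. composition \<gamma> \<and> \<beta> \<in> peelings n \<gamma>}"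
proof -
  have "\<beta> \<le>\<^sub>C \<gamma> \<and> skew_size \<gamma> \<beta> = n \<and> horizontal_strip (skew_cells \<gamma> \<beta>) \<and> added_left_to_right \<beta> \<gamma> \<longleftrightarrow>
      \<beta> \<in> peelings n \<gamma>" if \<gamma>: "composition \<gamma>" for \<gamma>
  proof -
    have "\<beta> \<le>\<^sub>C \<gamma> \<and> skew_size \<gamma> \<beta> = length cs \<and> horizontal_strip (skew_cells \<gamma> \<beta>)"
      if "saturated_chain \<beta> cs \<gamma>" "sorted_wrt (<) cs" for cs
      using le_C_if_saturated_chain[OF that(1)] saturated_chain_columns(3)[OF that(1) \<beta>]
        horizontal_strip_if_left_right_strip[OF \<beta> \<gamma> left_right_strip_if_chain[OF that(1) \<beta> that(2)]]
      by (simp add: skew_size_def)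
    then show ?thesis
      unfolding peelings_iff[OF \<beta> \<gamma>] added_left_to_right_def by metis
  qed
  then show ?thesis by blast
qed

lemma vertical_strips_eq:
  assumes \<beta>: "composition \<beta>"
  shows "{\<gamma>. composition \<gamma> \<and> \<beta> \<le>\<^sub>C \<gamma> \<and> skew_size \<gamma> \<beta> = n \<and>
      vertical_strip (skew_cells \<gamma> \<beta>) \<and> added_right_to_left \<beta> \<gamma>} =
    {\<gamma>. composition \<gamma> \<and> weakly_decreasing_chain n \<beta> \<gamma>}"
proof -
  have "\<beta> \<le>\<^sub>C \<gamma> \<and> skew_size \<gamma> \<beta> = n \<and> vertical_strip (skew_cells \<gamma> \<beta>) \<and> added_right_to_left \<beta> \<gamma> \<longleftrightarrow>
      weakly_decreasing_chain n \<beta> \<gamma>" for \<gamma>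
  proof -
    have "\<beta> \<le>\<^sub>C \<gamma> \<and> skew_size \<gamma> \<beta> = length cs \<and> vertical_strip (skew_cells \<gamma> \<beta>)"
      if "saturated_chain \<beta> cs \<gamma>" "sorted_wrt (\<ge>) cs" for cs
      using le_C_if_saturated_chain[OF that(1)] saturated_chain_columns(3)[OF that(1) \<beta>]
        vertical_strip_if_weakly_decreasing_chain[OF \<beta> that]
      by (simp add: skew_size_def)
    then show ?thesis
      unfolding weakly_decreasing_chain_def added_right_to_left_def by metis
  qed
  then show ?thesis by blast
qed

theorem corollary3p8:
  fixes n :: nat and \<beta> :: "nat list"
  assumes "n > 0" and "composition \<beta>"
  shows "dual_qschur [n] * dual_qschur \<beta> =
           (\<Sum>\<gamma> | composition \<gamma> \<and> \<beta> \<le>\<^sub>C \<gamma> \<and> skew_size \<gamma> \<beta> = n \<and>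
                  horizontal_strip (skew_cells \<gamma> \<beta>) \<and> added_left_to_right \<beta> \<gamma>.
              dual_qschur \<gamma>) \<and>
         dual_qschur (replicate n 1) * dual_qschur \<beta> =
           (\<Sum>\<gamma> | composition \<gamma> \<and> \<beta> \<le>\<^sub>C \<gamma> \<and> skew_size \<gamma> \<beta> = n \<and>
                  vertical_strip (skew_cells \<gamma> \<beta>) \<and> added_right_to_left \<beta> \<gamma>.
              dual_qschur \<gamma>)"
  unfolding horizontal_strips_eq[OF assms(2)] vertical_strips_eq[OF assms(2)]
proof (intro conjI eq_sum_dual_qschur)
  show "finite {\<gamma>. composition \<gamma> \<and> \<beta> \<in> peelings n \<gamma>}"
    by (rule finite_subset[OF _ finite_compositions[of "sum_list \<beta> + n"]])
      (auto simp: peelings_def left_right_strip_def sum_list_new_cells)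
  show "finite {\<gamma>. composition \<gamma> \<and> weakly_decreasing_chain n \<beta> \<gamma>}"
    by (rule finite_subset[OF _ finite_compositions[of "sum_list \<beta> + n"]])
      (auto simp: weakly_decreasing_chain_def dest: saturated_chain_columns(3)[OF _ assms(2)])
next
  fix \<gamma> assume \<gamma>: "composition \<gamma>"
  have "functional (dual_qschur [n] * dual_qschur \<beta>) (qschur \<gamma>) = (\<Sum>\<delta>\<in>peelings n \<gamma>. if \<delta> = \<beta> then 1 else 0)"
    unfolding complete_eq_dual_qschur[OF assms(1)] functional_complete_times_qschur[OF assms(1) \<gamma>]
    by (intro sum.cong) (auto simp: peelings_def functional_dual_qschur[OF assms(2)])
  then show "functional (dual_qschur [n] * dual_qschur \<beta>) (qschur \<gamma>) =
      of_bool (\<gamma> \<in> {\<gamma>. composition \<gamma> \<and> \<beta> \<in> peelings n \<gamma>})"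
    using \<gamma> by simp
  show "functional (dual_qschur (replicate n 1) * dual_qschur \<beta>) (qschur \<gamma>) =
      of_bool (\<gamma> \<in> {\<gamma>. composition \<gamma> \<and> weakly_decreasing_chain n \<beta> \<gamma>})"
    unfolding elementary_eq_dual_qschur functional_elementary_times_dual_qschur[OF assms(2) \<gamma>]
    using \<gamma> by simp
qed auto

end
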